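(* Let $(W,S)$ be a Coxeter system with $S$ finite and root system $\Phi$, let $X$ be an order coideal of $\mathbb R^+=\{\lambda\in\mathbb R:\lambda>0\}$, let $W'$ be a reflection subgroup of $W$, and let $\leq'$ (resp. $\leq'_{W'}$) denote the Bruhat order on $\Phi$ (resp. on $\Phi_{W'}$). (1) If $\beta,\beta'\in\Phi$ and $\beta\leq'\beta'$, then $d_X(\beta)\leq d_X(\beta')$. (2) If $\beta,\beta'\in\Phi_{W'}$ and $\beta\leq'_{W'}\beta'$, then $\beta\leq'\beta'$ and $$0\leq d_{W',X}(\beta')-d_{W',X}(\beta)\leq d_X(\beta')-d_X(\beta).$$ (3) If $\beta'\in\Phi_{W'}^+$, then $0\leq d_{W',X}(\beta')\leq d_X(\beta')$.
   Context: Geometric representation and roots. Fix a geometric representation of $(W,S)$: a real vector space $V$ with a symmetric bilinear form $B$, and a simple system $\Delta=\{\alpha_s : s\in S\}\subseteq V$ (finite, indexed bijectively by $S$) such that: $\sum_{\alpha\in\Delta}a_\alpha\alpha=0$ with all $a_\alpha\ge 0$ implies all $a_\alpha=0$; $B(\alpha,\beta)\in\,]-\infty,-1]\cup\{-\cos(\pi/k): k\in\mathbb N, k\geq 2\}$ for distinct $\alpha,\beta\in\Delta$; $B(\alpha,\alpha)=1$ for $\alpha\in\Delta$; and $W$ is faithfully represented in the group of linear maps preserving $B$, with $s\in S$ acting by $v\mapsto v-2B(\alpha_s,v)\alpha_s$. (So $B(\alpha_s,\alpha_t)=-\cos(\pi/m_{st})$ if the order $m_{st}$ of $st$ is finite,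 and $B(\alpha_s,\alpha_t)\le -1$ iff $m_{st}=\infty$.) The root system is $\Phi=W(\Delta)$; $\Phi^+$ is the set of roots that are non-negative linear combinations of $\Delta$, $\Phi^-=-\Phi^+$, and $\Phi=\Phi^+\sqcup\Phi^-$. For $\beta\in\Phi$, $s_\beta\in W$ is the reflection $v\mapsto v-2B(\beta,v)\beta$. The (left) inversion set of $w\in W$ is $N(w)=\Phi^+\cap w(\Phi^-)$. Reflection subgroups. For a reflection subgroup $W'$ of $W$ (a subgroup generated by reflections $s_\beta$, $\beta\in\Phi$), put $\Phi_{W'}=\{\beta\in\Phi: s_\beta\in W'\}$ and $\Phi_{W'}^+=\Phi_{W'}\cap\Phi^+$. Order coideals. $X\subseteq\mathbb R^+$ is an order coideal if $x\in X$ and $y\ge x$ imply $y\in X$; i.e. $X$ is $\emptyset$, $\mathbb R^+$, or a ray $[a,\infty[$ or $]a,\infty[$ with $a>0$. $X$-length. $d_X:\Phi\to\mathbb Z$ is defined by $d_X(\pm\beta)=\pm|\{\alpha\in N(s_\beta): B(\alpha,\beta)\in X\}|$ for $\beta\in\Phi^+$. Similarly $d_{W',X}:\Phi_{W'}\to\mathbb Z$ is defined by $d_{W',X}(\pm\beta)=\pm|\{\alpha\in N(s_\beta)\cap\Phi_{W'}: B(\alpha,\beta)\in X\}|$ for $\beta\in\Phi_{W'}^+$. Bruhat order on roots. $\leq'$ is the reflexive transitive closure of the relation on $\Phi$: $\alpha\lessdot'\beta$ iff there is $\gamma\in\Phi^+$ with $B(\gamma,\alpha)<0$ and $\beta=s_\gamma(\alpha)$.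 Likewise $\leq'_{W'}$ is the reflexive transitive closure of the relation on $\Phi_{W'}$: $\alpha\lessdot'_{W'}\beta$ iff there is $\gamma\in\Phi_{W'}^+$ with $B(\gamma,\alpha)<0$ and $\beta=s_\gamma(\alpha)$. *)

theory Defs
  imports "HOL-Analysis.Analysis" "HOL-Algebra.Multiplicative_Group" "HOL-Algebra.Generated_Groups"
begin

section \<open>Coxeter systems\<close>

text \<open>
  One application of a defining relation to a word in the generators: a factor
  \<open>(s t)\<^sup>m\<close>, with \<open>m\<close> the order of \<open>s t\<close>, is deleted.  Since \<open>group.ord\<close> is \<open>0\<close> for elements
  of infinite order, no relation arises for such pairs; for \<open>s = t\<close> the order is \<open>1\<close> and the
  relation is \<open>s s = 1\<close>.  As every generator is its own inverse modulo these relations, words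
  in the generators alone (without formal inverses) suffice to express the group presentation.
\<close>

inductive coxeter_step :: "('w, 'm) monoid_scheme \<Rightarrow> 'w set \<Rightarrow> 'w list \<Rightarrow> 'w list \<Rightarrow> bool"
  for G (structure) and S where
  "\<lbrakk>u \<in> lists S; v \<in> lists S; s \<in> S; t \<in> S\<rbrakk> \<Longrightarrow>
     coxeter_step G S (u @ concat (replicate (group.ord G (s \<otimes> t)) [s, t]) @ v) (u @ v)"

definition word_prod :: "('w, 'm) monoid_scheme \<Rightarrow> 'w list \<Rightarrow> 'w" where
  "word_prod G ws = foldr (mult G) ws (one G)"

locale coxeter_system = group G for G (structure) +
  fixes S
  assumes gens_closed: "S \<subseteq> carrier G"
    and gens_generate: "generate G S = carrier G"
    and gens_ord: "s \<in> S \<Longrightarrow> ord s = 2"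
    and presentation: "\<lbrakk>ws \<in> lists S; word_prod G ws = \<one>\<rbrakk> \<Longrightarrow> equivclp (coxeter_step G S) ws []"

section \<open>Geometric representations\<close>

definition reflection :: "('v \<Rightarrow> 'v \<Rightarrow> real) \<Rightarrow> 'v \<Rightarrow> 'v \<Rightarrow> 'v::real_vector" where
  "reflection B \<beta> v = v - (2 * B \<beta> v) *\<^sub>R \<beta>"

definition isometry_group :: "('v::real_vector \<Rightarrow> 'v \<Rightarrow> real) \<Rightarrow> ('v \<Rightarrow> 'v) monoid" where
  "isometry_group B =
     \<lparr>carrier = {f. linear f \<and> bij f \<and> (\<forall>x y. B (f x) (f y) = B x y)}, mult = (\<circ>), one = id\<rparr>"

text \<open>
  A group together with generators \<open>S\<close>, a form \<open>B\<close> on the space \<open>'v\<close>, the vectors \<open>\<alpha>\<^sub>s\<close>,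
  and an action on \<open>'v\<close>.
\<close>

record ('w, 'v) coxeter_data = "'w monoid" +
  gens :: "'w set"
  form :: "'v \<Rightarrow> 'v \<Rightarrow> real"
  simple_root :: "'w \<Rightarrow> 'v"
  act :: "'w \<Rightarrow> 'v \<Rightarrow> 'v"

locale geometric_representation =
  fixes W :: "('w, 'v::real_vector, 'm) coxeter_data_scheme" (structure)
  assumes coxeter: "coxeter_system W (gens W)"
    and finite_gens: "finite (gens W)"
    and form_bilinear: "bilinear (form W)"
    and form_sym: "form W x y = form W y x"
    and simple_inj: "inj_on (simple_root W) (gens W)"
    and simple_pos_indep:
      "\<lbrakk>\<And>s. s \<in> gens W \<Longrightarrow> 0 \<le> a s; (\<Sum>s\<in>gens W. a s *\<^sub>R simple_root W s) = 0; t \<in> gens W\<rbrakk>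
        \<Longrightarrow> a t = (0::real)"
    and simple_form:
      "\<lbrakk>s \<in> gens W; t \<in> gens W; s \<noteq> t\<rbrakk> \<Longrightarrow>
        form W (simple_root W s) (simple_root W t) \<in> {..-1} \<union> {- cos (pi / real k) | k::nat. 2 \<le> k}"
    and simple_norm: "s \<in> gens W \<Longrightarrow> form W (simple_root W s) (simple_root W s) = 1"
    and act_hom: "act W \<in> hom W (isometry_group (form W))"
    and act_faithful: "inj_on (act W) (carrier W)"
    and act_gens: "s \<in> gens W \<Longrightarrow> act W s = reflection (form W) (simple_root W s)"

section \<open>Roots, reflections and inversion sets\<close>

definition roots :: "('w, 'v::real_vector, 'm) coxeter_data_scheme \<Rightarrow> 'v set" where
  "roots W = {act W w (simple_root W s) | w s. w \<in> carrier W \<and> s \<in> gens W}"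

definition pos_roots :: "('w, 'v::real_vector, 'm) coxeter_data_scheme \<Rightarrow> 'v set" where
  "pos_roots W = {\<beta> \<in> roots W. \<exists>a. (\<forall>s\<in>gens W. 0 \<le> a s) \<and>
                                  \<beta> = (\<Sum>s\<in>gens W. a s *\<^sub>R simple_root W s)}"

definition neg_roots :: "('w, 'v::real_vector, 'm) coxeter_data_scheme \<Rightarrow> 'v set" where
  "neg_roots W = uminus ` pos_roots W"

text \<open>The group element \<open>s\<^sub>\<beta>\<close>; meaningful for roots \<open>\<beta>\<close>, whose reflections lie in the image of \<open>act\<close>.\<close>

definition root_refl :: "('w, 'v::real_vector, 'm) coxeter_data_scheme \<Rightarrow> 'v \<Rightarrow> 'w" where
  "root_refl W \<beta> = the_inv_into (carrier W) (act W) (reflection (form W) \<beta>)"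

definition inversions :: "('w, 'v::real_vector, 'm) coxeter_data_scheme \<Rightarrow> 'w \<Rightarrow> 'v set" where
  "inversions W w = pos_roots W \<inter> act W w ` neg_roots W"

definition reflection_subgroup ::
    "('w, 'v::real_vector, 'm) coxeter_data_scheme \<Rightarrow> 'w set \<Rightarrow> bool" where
  "reflection_subgroup W W' \<longleftrightarrow> (\<exists>R \<subseteq> roots W. W' = generate W (root_refl W ` R))"

definition sub_roots :: "('w, 'v::real_vector, 'm) coxeter_data_scheme \<Rightarrow> 'w set \<Rightarrow> 'v set" where
  "sub_roots W W' = {\<beta> \<in> roots W. root_refl W \<beta> \<in> W'}"

definition sub_pos_roots :: "('w, 'v::real_vector, 'm) coxeter_data_scheme \<Rightarrow> 'w set \<Rightarrow> 'v set" where
  "sub_pos_roots W W' = sub_roots W W' \<inter> pos_roots W"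

section \<open>X-length and Bruhat order on roots\<close>

definition order_coideal :: "real set \<Rightarrow> bool" where
  "order_coideal X \<longleftrightarrow> X \<subseteq> {0<..} \<and> (\<forall>x\<in>X. \<forall>y\<ge>x. y \<in> X)"

text \<open>
  In both definitions of lengths, the \<open>else\<close> branch is the case of a negative root \<open>\<beta>\<close>,
  the functions being intended for arguments in \<open>roots W\<close> and \<open>sub_roots W W'\<close>, respectively.
\<close>

definition X_length :: "('w, 'v::real_vector, 'm) coxeter_data_scheme \<Rightarrow> real set \<Rightarrow> 'v \<Rightarrow> int" where
  "X_length W X \<beta> =
     (let n = (\<lambda>\<beta>. int (card {\<alpha> \<in> inversions W (root_refl W \<beta>). form W \<alpha> \<beta> \<in> X}))
      in if \<beta> \<in> pos_roots W then n \<beta> else - n (- \<beta>))"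

definition sub_X_length ::
    "('w, 'v::real_vector, 'm) coxeter_data_scheme \<Rightarrow> 'w set \<Rightarrow> real set \<Rightarrow> 'v \<Rightarrow> int" where
  "sub_X_length W W' X \<beta> =
     (let n = (\<lambda>\<beta>. int (card {\<alpha> \<in> inversions W (root_refl W \<beta>) \<inter> sub_roots W W'.
                                form W \<alpha> \<beta> \<in> X}))
      in if \<beta> \<in> sub_pos_roots W W' then n \<beta> else - n (- \<beta>))"

definition bruhat_step :: "('w, 'v::real_vector, 'm) coxeter_data_scheme \<Rightarrow> 'v \<Rightarrow> 'v \<Rightarrow> bool" where
  "bruhat_step W \<alpha> \<beta> \<longleftrightarrow> \<alpha> \<in> roots W \<and> \<beta> \<in> roots W \<and>
     (\<exists>\<gamma>\<in>pos_roots W. form W \<gamma> \<alpha> < 0 \<and> \<beta> = reflection (form W) \<gamma> \<alpha>)"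

definition bruhat_le :: "('w, 'v::real_vector, 'm) coxeter_data_scheme \<Rightarrow> 'v \<Rightarrow> 'v \<Rightarrow> bool" where
  "bruhat_le W = (bruhat_step W)\<^sup>*\<^sup>*"

definition sub_bruhat_step ::
    "('w, 'v::real_vector, 'm) coxeter_data_scheme \<Rightarrow> 'w set \<Rightarrow> 'v \<Rightarrow> 'v \<Rightarrow> bool" where
  "sub_bruhat_step W W' \<alpha> \<beta> \<longleftrightarrow> \<alpha> \<in> sub_roots W W' \<and> \<beta> \<in> sub_roots W W' \<and>
     (\<exists>\<gamma>\<in>sub_pos_roots W W'. form W \<gamma> \<alpha> < 0 \<and> \<beta> = reflection (form W) \<gamma> \<alpha>)"

definition sub_bruhat_le ::
    "('w, 'v::real_vector, 'm) coxeter_data_scheme \<Rightarrow> 'w set \<Rightarrow> 'v \<Rightarrow> 'v \<Rightarrow> bool" where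
  "sub_bruhat_le W W' = (sub_bruhat_step W W')\<^sup>*\<^sup>*"

end

theory Submission
  imports Defs
begin

text \<open>
  Let \<open>p\<close> be the indicator function of the positive roots.  Unwinding the signs in the definition
  gives one formula for the \<open>X\<close>-length of positive and negative roots alike:
  \<open>d(\<beta>) = \<Sum> p(a) - p(s\<^sub>\<beta> a)\<close>, summed over the roots \<open>a\<close> with \<open>B(a, \<beta>) \<in> X\<close>
  (lemma \<open>signed_count_sum\<close>).  The same holds inside any set \<open>\<Psi>\<close> of roots that is closed under its own
  reflections, in particular inside the root system of a reflection subgroup.

  Let \<open>\<beta>' = s\<^sub>\<gamma> \<beta>\<close> with \<open>\<gamma>\<close> positive and \<open>B(\<gamma>, \<beta>) < 0\<close>, and let \<open>f = 1\<^sub>X - 1\<^sub>-\<^sub>X\<close> be the odd extension of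
  the indicator function of \<open>X\<close>, a monotone function on the reals.  As
  \<open>s\<^sub>\<beta>\<^sub>' = s\<^sub>\<gamma> s\<^sub>\<beta> s\<^sub>\<gamma>\<close>, substitutions in the sums for \<open>\<beta>\<close> and \<open>\<beta>'\<close> lead to
  \<open>2 (d(\<beta>') - d(\<beta>)) = \<Sum> (p(s\<^sub>\<gamma> a) - p(a)) (f(B(a, \<beta>)) - f(B(s\<^sub>\<gamma> a, \<beta>)))\<close>,
  a finite sum over the roots \<open>a \<in> \<Psi>\<close> whose sign is changed by \<open>s\<^sub>\<gamma>\<close> (\<open>signed_count_reflection\<close>).
  If \<open>s\<^sub>\<gamma>\<close> makes \<open>a\<close> negative then \<open>B(\<gamma>, a) > 0\<close>, hence
  \<open>B(s\<^sub>\<gamma> a, \<beta>) = B(a, \<beta>) - 2 B(\<gamma>, a) B(\<gamma>, \<beta>) > B(a, \<beta>)\<close>, and the term is nonnegative because \<open>f\<close> is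
  monotone; the other case is symmetric (\<open>gain_nonneg\<close>).  So each Bruhat step increases \<open>d\<close> weakly.
  The terms do not depend on \<open>\<Psi>\<close>, so the increase for a reflection subgroup is a partial sum of
  the increase for the whole group.  The comparison of the lengths themselves for a positive root is an
  inclusion of finite sets.

  The argument rests on the two basic facts about roots: every root is positive or negative, and a
  group element changes the sign of only finitely many of them.  They are derived
  from the values of the form on simple roots, via Deodhar's reduction to dihedral groups
  (\<open>positive_of_len_le\<close>) and the fact that a simple reflection permutes the positive roots other than
  its own (\<open>simple_reflection_permutes_positive\<close>).
\<close>


section \<open>Words in the simple reflections\<close>

text \<open>
  The linear data of a geometric representation without the abstract group: a family \<open>\<alpha>\<close> indexed
  by \<open>S\<close> that need not be linearly independent, only positively so.  Group elements are represented
  by the maps that words in the simple reflections induce.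
\<close>

locale simple_system =
  fixes B :: "'v::real_vector \<Rightarrow> 'v \<Rightarrow> real" and S :: "'i set" and \<alpha> :: "'i \<Rightarrow> 'v"
  assumes bilin: "bilinear B"
    and sym: "B x y = B y x"
    and fin: "finite S"
    and pos_indep:
      "\<lbrakk>\<And>s. s \<in> S \<Longrightarrow> 0 \<le> a s; (\<Sum>s\<in>S. a s *\<^sub>R \<alpha> s) = 0; t \<in> S\<rbrakk> \<Longrightarrow> a t = (0::real)"
    and off_diag:
      "\<lbrakk>s \<in> S; t \<in> S; s \<noteq> t\<rbrakk> \<Longrightarrow> B (\<alpha> s) (\<alpha> t) \<in> {..-1} \<union> {- cos (pi / real k) | k::nat. 2 \<le> k}"
    and unit: "s \<in> S \<Longrightarrow> B (\<alpha> s) (\<alpha> s) = 1"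
begin

lemmas B_simps = bilinear_ladd[OF bilin] bilinear_radd[OF bilin] bilinear_lmul[OF bilin]
  bilinear_rmul[OF bilin] bilinear_lsub[OF bilin] bilinear_rsub[OF bilin]
  bilinear_lneg[OF bilin] bilinear_rneg[OF bilin] bilinear_lzero[OF bilin] bilinear_rzero[OF bilin]

lemma reflection_form: "B \<beta> \<beta> = 1 \<Longrightarrow> B (reflection B \<beta> x) (reflection B \<beta> y) = B x y"
  by (simp add: reflection_def B_simps sym[of x \<beta>] algebra_simps)

lemma reflection_involutive: "B \<beta> \<beta> = 1 \<Longrightarrow> reflection B \<beta> (reflection B \<beta> x) = x"
  by (simp add: reflection_def B_simps algebra_simps)

lemma reflection_lincomb:
  "reflection B \<beta> (a *\<^sub>R x + b *\<^sub>R y) = a *\<^sub>R reflection B \<beta> x + b *\<^sub>R reflection B \<beta> y"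
  by (simp add: reflection_def B_simps algebra_simps)

lemma reflection_self: "B \<beta> \<beta> = 1 \<Longrightarrow> reflection B \<beta> \<beta> = - \<beta>"
  by (simp add: reflection_def algebra_simps scaleR_2)

definition word_map :: "'i list \<Rightarrow> 'v \<Rightarrow> 'v" where
  "word_map ws = foldr (\<lambda>s f. reflection B (\<alpha> s) \<circ> f) ws id"

lemma word_map_Nil [simp]: "word_map [] = id"
  and word_map_Cons [simp]: "word_map (s # ws) = reflection B (\<alpha> s) \<circ> word_map ws"
  by (simp_all add: word_map_def)

lemma word_map_append [simp]: "word_map (us @ ws) = word_map us \<circ> word_map ws"
  by (induction us) (simp_all add: comp_assoc)

lemma word_map_form: "ws \<in> lists S \<Longrightarrow> B (word_map ws x) (word_map ws y) = B x y"
  by (induction ws) (auto simp: reflection_form unit)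

lemma word_map_lincomb:
  "word_map ws (a *\<^sub>R x + b *\<^sub>R y) = a *\<^sub>R word_map ws x + b *\<^sub>R word_map ws y"
  by (induction ws) (simp_all add: reflection_lincomb)

lemma word_map_neg: "word_map ws (- x) = - word_map ws x"
  using word_map_lincomb[of ws "-1" x 0 0] by simp

lemma word_map_rev: "ws \<in> lists S \<Longrightarrow> word_map ws \<circ> word_map (rev ws) = id"
proof (induction ws)
  case (Cons s ws)
  then have "word_map (s # ws) \<circ> word_map (rev (s # ws))
    = reflection B (\<alpha> s) \<circ> (word_map ws \<circ> word_map (rev ws)) \<circ> reflection B (\<alpha> s)"
    by (simp add: comp_assoc)
  also have "\<dots> = id"
    using Cons by (auto simp: fun_eq_iff reflection_involutive unit)
  finally show ?case .
qed simp

lemma inj_word_map: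
  assumes "ws \<in> lists S"
  shows "inj (word_map ws)"
proof (rule inj_on_inverseI)
  fix x
  have "rev ws \<in> lists S" using assms by auto
  from word_map_rev[OF this] show "word_map (rev ws) (word_map ws x) = x"
    by (simp add: fun_eq_iff)
qed

text \<open>The index set is a parameter because word lengths in \<open>S\<close> are compared with those in a pair \<open>{s, t}\<close>.\<close>

definition len :: "'i set \<Rightarrow> ('v \<Rightarrow> 'v) \<Rightarrow> nat" where
  "len I g = (LEAST n. \<exists>ws\<in>lists I. length ws = n \<and> word_map ws = g)"

lemma len_le: "ws \<in> lists I \<Longrightarrow> len I (word_map ws) \<le> length ws"
  unfolding len_def by (rule Least_le) blast

lemma reduced_word:
  assumes "g \<in> word_map ` lists I"
  obtains ws where "ws \<in> lists I" "length ws = len I g" "word_map ws = g"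
proof -
  have "\<exists>ws\<in>lists I. length ws = len I g \<and> word_map ws = g"
    unfolding len_def by (rule LeastI_ex) (use assms in blast)
  with that show thesis by blast
qed

lemma len_comp_le:
  assumes "g \<in> word_map ` lists I" "h \<in> word_map ` lists I"
  shows "len I (g \<circ> h) \<le> len I g + len I h"
proof -
  obtain us ws where "us \<in> lists I" "length us = len I g" "word_map us = g"
    "ws \<in> lists I" "length ws = len I h" "word_map ws = h"
    using assms reduced_word by metis
  then show ?thesis using len_le[of "us @ ws" I] by auto
qed

lemma comp_in_words:
  assumes "g \<in> word_map ` lists I" "h \<in> word_map ` lists I"
  shows "g \<circ> h \<in> word_map ` lists I"
proof -
  obtain us ws where "us \<in> lists I" "g = word_map us" "ws \<in> lists I" "h = word_map ws"
    using assms by blast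
  then show ?thesis by (intro image_eqI[of _ _ "us @ ws"]) auto
qed

lemma refl_in_words: "s \<in> I \<Longrightarrow> reflection B (\<alpha> s) \<in> word_map ` lists I"
  by (rule image_eqI[of _ _ "[s]"]) auto

lemma len_refl_le: "s \<in> I \<Longrightarrow> len I (reflection B (\<alpha> s)) \<le> 1"
  using len_le[of "[s]" I] by simp

lemma refl_comp_refl: "s \<in> S \<Longrightarrow> reflection B (\<alpha> s) \<circ> reflection B (\<alpha> s) = id"
  by (auto simp: fun_eq_iff reflection_involutive unit)

section \<open>Dihedral subgroups\<close>

text \<open>
  The alternating word in \<open>x\<close> and \<open>y\<close> of length \<open>k\<close> whose last letter is \<open>y\<close>.  As words act from the
  left, the last letter is the first reflection to be applied.
\<close>

fun alternating :: "'i \<Rightarrow> 'i \<Rightarrow> nat \<Rightarrow> 'i list" where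
  "alternating x y 0 = []"
| "alternating x y (Suc k) = alternating y x k @ [y]"

lemma alternating_in_lists: "alternating x y k \<in> lists {x, y}"
  by (induction k arbitrary: x y) (fastforce simp: insert_commute)+

lemma length_alternating [simp]: "length (alternating x y k) = k"
  by (induction k arbitrary: x y) auto

lemma alternating_split: "\<exists>p\<in>lists {x, y}. length p = j \<and> alternating x y (j + m) = p @ alternating x y m"
proof (induction m arbitrary: x y)
  case 0
  show ?case by (rule bexI[OF _ alternating_in_lists[of x y j]]) simp
next
  case (Suc m)
  from Suc[of y x] show ?case by (auto simp: insert_commute)
qed

text \<open>
  Adjacent equal letters cancel, so appending a letter to an alternating word either lengthens or
  shortens it by one.
\<close>

lemma word_alternating:
  assumes "s \<in> S" "t \<in> S" "ws \<in> lists {s, t}"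
  shows "\<exists>k\<le>length ws. word_map ws = word_map (alternating s t k) \<or> word_map ws = word_map (alternating t s k)"
  using assms(3)
proof (induction ws rule: rev_induct)
  case (snoc x ws)
  have step: "\<exists>j\<le>Suc k. word_map (alternating a b k) \<circ> reflection B (\<alpha> x) = word_map (alternating a b j)
      \<or> word_map (alternating a b k) \<circ> reflection B (\<alpha> x) = word_map (alternating b a j)"
    if "a \<in> S" "b \<in> S" "x = a \<or> x = b" for a b k
  proof (cases "x = a")
    case True
    then show ?thesis by (intro exI[of _ "Suc k"]) simp
  next
    case False
    then have x: "x = b" using that by simp
    show ?thesis
    proof (cases k)
      case 0
      then show ?thesis by (intro exI[of _ 1]) (simp add: x)
    next
      case (Suc n)
      then show ?thesis
        by (intro exI[of _ n]) (simp add: x comp_assoc refl_comp_refl that)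
    qed
  qed
  obtain k where k: "k \<le> length ws"
    "word_map ws = word_map (alternating s t k) \<or> word_map ws = word_map (alternating t s k)"
    using snoc by auto
  have "x = s \<or> x = t" using snoc by auto
  with k step[of s t k] step[of t s k] assms(1,2)
  have "\<exists>j\<le>Suc k. word_map (ws @ [x]) = word_map (alternating s t j) \<or> word_map (ws @ [x]) = word_map (alternating t s j)"
    by auto
  with k(1) show ?case by (metis Suc_le_mono le_trans length_append_singleton)
qed auto

lemma reflection_pair:
  assumes "t \<in> S"
  shows "reflection B (\<alpha> t) (a *\<^sub>R \<alpha> s + b *\<^sub>R \<alpha> t) = (- 2 * B (\<alpha> s) (\<alpha> t) * a - b) *\<^sub>R \<alpha> t + a *\<^sub>R \<alpha> s"
  using assms by (simp add: reflection_def B_simps unit sym[of "\<alpha> t" "\<alpha> s"] algebra_simps flip: scaleR_add_left)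

text \<open>
  In an infinite dihedral group the invariant \<open>0 \<le> b \<le> a\<close> propagates: reflecting in \<open>\<alpha> t\<close> replaces
  \<open>b\<close> by \<open>2 c a - b \<ge> a\<close> with \<open>c = - B (\<alpha> s) (\<alpha> t) \<ge> 1\<close>, and then \<open>s\<close> and \<open>t\<close> exchange their roles.
\<close>

lemma alternating_cone_of_form_le_minus_1:
  assumes "s \<in> S" "t \<in> S" "B (\<alpha> s) (\<alpha> t) \<le> -1" "0 \<le> b" "b \<le> a"
  shows "\<exists>a'\<ge>0. \<exists>b'\<ge>0. word_map (alternating s t k) (a *\<^sub>R \<alpha> s + b *\<^sub>R \<alpha> t) = a' *\<^sub>R \<alpha> s + b' *\<^sub>R \<alpha> t"
  using assms
proof (induction k arbitrary: s t a b)
  case 0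
  then show ?case by (intro exI[of _ a] conjI exI[of _ b]) simp_all
next
  case (Suc k)
  let ?b = "- 2 * B (\<alpha> s) (\<alpha> t) * a - b"
  have eq: "reflection B (\<alpha> t) (a *\<^sub>R \<alpha> s + b *\<^sub>R \<alpha> t) = ?b *\<^sub>R \<alpha> t + a *\<^sub>R \<alpha> s"
    by (rule reflection_pair) (use Suc.prems in simp)
  have "B (\<alpha> s) (\<alpha> t) * a \<le> (-1) * a"
    by (rule mult_right_mono) (use Suc.prems in auto)
  then have "a \<le> ?b" using Suc.prems by auto
  moreover have "B (\<alpha> t) (\<alpha> s) \<le> -1" using Suc.prems sym[of "\<alpha> t" "\<alpha> s"] by simp
  ultimately obtain a' b' where "a' \<ge> 0" "b' \<ge> 0"
    "word_map (alternating t s k) (?b *\<^sub>R \<alpha> t + a *\<^sub>R \<alpha> s) = a' *\<^sub>R \<alpha> t + b' *\<^sub>R \<alpha> s"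
    using Suc.IH[of t s a ?b] Suc.prems by auto
  then show ?case by (intro exI[of _ b'] conjI exI[of _ a']) (simp_all add: eq add.commute)
qed

text \<open>
  If \<open>B (\<alpha> s) (\<alpha> t) = - cos \<theta>\<close> and \<open>sin \<theta> > 0\<close>, the plane of \<open>\<alpha> s\<close> and \<open>\<alpha> t\<close> is Euclidean.  This is its unit vector at
  angle \<open>\<phi>\<close> from \<open>\<alpha> s\<close>, measured towards \<open>\<alpha> t\<close>, which itself lies at angle \<open>\<pi> - \<theta>\<close>.  In these
  coordinates the reflections act by affine maps of the angle.
\<close>

definition polar :: "real \<Rightarrow> 'i \<Rightarrow> 'i \<Rightarrow> real \<Rightarrow> 'v" where
  "polar \<theta> s t \<phi> = (sin (\<phi> + \<theta>) / sin \<theta>) *\<^sub>R \<alpha> s + (sin \<phi> / sin \<theta>) *\<^sub>R \<alpha> t"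

text \<open>
  Measuring from the other simple root.  With this change of frame every reflection simply adds
  \<open>\<theta>\<close> to the angle, which makes iterating an alternating word trivial.
\<close>

lemma polar_swap: "polar \<theta> t s \<phi> = polar \<theta> s t (pi - \<theta> - \<phi>)"
proof -
  have "sin (pi - \<theta> - \<phi>) = sin (\<phi> + \<theta>)"
    using sin_pi_minus[of "\<theta> + \<phi>"] by (simp add: algebra_simps)
  then show ?thesis by (simp add: polar_def add.commute)
qed

lemma polar_pi: "polar \<theta> s t (\<phi> + pi) = - polar \<theta> s t \<phi>"
proof -
  have "sin (\<phi> + pi + \<theta>) = - sin (\<phi> + \<theta>)"
    using sin_periodic_pi[of "\<phi> + \<theta>"] by (simp add: algebra_simps)
  then show ?thesis by (simp add: polar_def)
qed

lemma reflection_polar: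
  assumes "s \<in> S" "t \<in> S" "B (\<alpha> s) (\<alpha> t) = - cos \<theta>" "sin \<theta> \<noteq> 0"
  shows "reflection B (\<alpha> t) (polar \<theta> s t \<phi>) = polar \<theta> t s (\<phi> + \<theta>)"
proof -
  have "sin (\<phi> + \<theta> + \<theta>) = 2 * cos \<theta> * sin (\<phi> + \<theta>) - sin \<phi>"
  proof -
    have "sin \<phi> = sin ((\<phi> + \<theta>) - \<theta>)" by simp
    also have "\<dots> = sin (\<phi> + \<theta>) * cos \<theta> - cos (\<phi> + \<theta>) * sin \<theta>" by (rule sin_diff)
    finally show ?thesis
      by (simp only: sin_add[of "\<phi> + \<theta>" \<theta>]) (simp add: algebra_simps)
  qed
  then have "sin (\<phi> + \<theta> + \<theta>) / sin \<theta>
      = - 2 * B (\<alpha> s) (\<alpha> t) * (sin (\<phi> + \<theta>) / sin \<theta>) - sin \<phi> / sin \<theta>"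
    by (simp add: assms(3) diff_divide_distrib)
  then show ?thesis unfolding polar_def by (simp only: reflection_pair[OF assms(2)])
qed

lemma alternating_polar:
  assumes "s \<in> S" "t \<in> S" "B (\<alpha> s) (\<alpha> t) = - cos \<theta>" "sin \<theta> \<noteq> 0"
  shows "word_map (alternating s t k) (polar \<theta> s t \<phi>)
    = (if even k then polar \<theta> s t (\<phi> + k * \<theta>) else polar \<theta> t s (\<phi> + k * \<theta>))"
  using assms
proof (induction k arbitrary: s t \<phi>)
  case (Suc k)
  then have "B (\<alpha> t) (\<alpha> s) = - cos \<theta>" using sym by metis
  with Suc show ?case by (simp add: reflection_polar algebra_simps)
qed simp

lemma word_map_fixes_orthogonal:
  "\<lbrakk>ws \<in> lists I; \<And>s. s \<in> I \<Longrightarrow> B (\<alpha> s) u = 0\<rbrakk> \<Longrightarrow> word_map ws u = u"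
  by (induction ws) (auto simp: reflection_def)

text \<open>
  Both words turn the plane of \<open>\<alpha> s\<close> and \<open>\<alpha> t\<close> in the same way, by the polar description with
  \<open>m \<theta> = \<pi>\<close>, and both fix its orthogonal complement.  Since \<open>B\<close> is nondegenerate on the plane, the two
  subspaces span everything.
\<close>

lemma braid:
  assumes "s \<in> S" "t \<in> S" "B (\<alpha> s) (\<alpha> t) = - cos (pi / real m)" "2 \<le> m"
  shows "word_map (alternating s t m) = word_map (alternating t s m)"
proof
  fix v
  define \<theta> where "\<theta> = pi / real m"
  have th: "0 < \<theta>" "\<theta> < pi" "real m * \<theta> = pi"
    using assms(4) by (auto simp: \<theta>_def field_simps)
  have nz: "sin \<theta> \<noteq> 0" using sin_gt_zero[OF th(1,2)] by simp
  have st: "B (\<alpha> s) (\<alpha> t) = - cos \<theta>" "B (\<alpha> t) (\<alpha> s) = - cos \<theta>"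
    using assms(3) sym by (auto simp: \<theta>_def)
  have on_polar: "word_map (alternating s t m) (polar \<theta> s t \<phi>) = word_map (alternating t s m) (polar \<theta> s t \<phi>)" for \<phi>
  proof -
    have "word_map (alternating t s m) (polar \<theta> t s \<psi>) = (if even m then - polar \<theta> t s \<psi> else - polar \<theta> s t \<psi>)" for \<psi>
      by (simp add: alternating_polar[OF assms(2,1) st(2) nz] th(3) polar_pi)
    moreover have "word_map (alternating s t m) (polar \<theta> s t \<phi>) = (if even m then - polar \<theta> s t \<phi> else - polar \<theta> t s \<phi>)"
      by (simp add: alternating_polar[OF assms(1,2) st(1) nz] th(3) polar_pi)
    moreover have "polar \<theta> s t \<phi> = polar \<theta> t s (pi - \<theta> - \<phi>)" "polar \<theta> t s \<phi> = polar \<theta> s t (pi - \<theta> - \<phi>)"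
      by (rule polar_swap)+
    ultimately show ?thesis by metis
  qed
  have pst: "polar \<theta> s t 0 = \<alpha> s" "polar \<theta> s t (pi - \<theta>) = \<alpha> t"
    using nz by (simp_all add: polar_def sin_diff)
  \<comment> \<open>The orthogonal projection \<open>p \<alpha>\<^sub>s + q \<alpha>\<^sub>t\<close> of \<open>v\<close> to the plane, by Cramer's rule; \<open>D\<close> is the Gram determinant.\<close>
  define x y D where "x = B (\<alpha> s) v" and "y = B (\<alpha> t) v" and "D = (sin \<theta>)\<^sup>2"
  have D: "D \<noteq> 0" "D = 1 - (cos \<theta>)\<^sup>2"
    using nz by (simp add: D_def) (simp add: D_def sin_squared_eq)
  define p q where "p = (x + cos \<theta> * y) / D" and "q = (y + cos \<theta> * x) / D"
  define u where "u = v - (p *\<^sub>R \<alpha> s + q *\<^sub>R \<alpha> t)"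
  have pq: "p - cos \<theta> * q = x" "q - cos \<theta> * p = y"
    using D(1) by (simp_all add: p_def q_def field_simps) (simp_all add: D(2) algebra_simps power2_eq_square)
  have orth: "B (\<alpha> s) u = 0" "B (\<alpha> t) u = 0"
    using pq assms(1,2) by (simp_all add: u_def B_simps unit st x_def y_def algebra_simps)
  have fix_u: "word_map (alternating s t m) u = u" "word_map (alternating t s m) u = u"
    by (rule word_map_fixes_orthogonal[OF alternating_in_lists]; use orth in auto)+
  have v: "v = 1 *\<^sub>R u + 1 *\<^sub>R (p *\<^sub>R \<alpha> s + q *\<^sub>R \<alpha> t)" by (simp add: u_def)
  show "word_map (alternating s t m) v = word_map (alternating t s m) v"
    by (subst (1 2) v) (simp only: word_map_lincomb fix_u on_polar[of 0, unfolded pst]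
        on_polar[of "pi - \<theta>", unfolded pst])
qed

text \<open>
  The element \<open>g\<close> equals an alternating word of minimal length.  By the length hypothesis this word
  does not end in \<open>s\<close>; if \<open>B (\<alpha> s) (\<alpha> t) = - cos (\<pi> / m)\<close>, it has fewer than \<open>m\<close> letters, because the
  braid relation would otherwise produce an equally long word ending in \<open>s\<close>.  For such words the image of \<open>\<alpha> s\<close> is known explicitly.
\<close>

lemma dihedral_positive:
  assumes st: "s \<in> S" "t \<in> S" "s \<noteq> t" and g: "g \<in> word_map ` lists {s, t}"
    and le: "len {s, t} g \<le> len {s, t} (g \<circ> reflection B (\<alpha> s))"
  shows "\<exists>a\<ge>0. \<exists>b\<ge>0. g (\<alpha> s) = a *\<^sub>R \<alpha> s + b *\<^sub>R \<alpha> t"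
proof -
  obtain ws where ws: "ws \<in> lists {s, t}" "length ws = len {s, t} g" "word_map ws = g"
    using reduced_word[OF g] by blast
  obtain k where k: "k \<le> len {s, t} g" "g = word_map (alternating s t k) \<or> g = word_map (alternating t s k)"
    using word_alternating[OF st(1,2) ws(1)] ws by auto
  have no_short: False if "w \<in> lists {s, t}" "length w < k" "g \<circ> reflection B (\<alpha> s) = word_map w" for w
    using len_le[OF that(1)] that le k(1) by simp
  have g_alternating: "g = word_map (alternating s t k)"
  proof (rule ccontr)
    assume "g \<noteq> word_map (alternating s t k)"
    with k(2) have *: "g = word_map (alternating t s k)" "k \<noteq> 0" by auto
    then obtain n where "k = Suc n" by (cases k) auto
    with * have "g \<circ> reflection B (\<alpha> s) = word_map (alternating s t n)"
      by (simp add: comp_assoc refl_comp_refl st)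
    then show False using no_short[of "alternating s t n"] alternating_in_lists[of s t n] \<open>k = Suc n\<close> by simp
  qed
  consider "B (\<alpha> s) (\<alpha> t) \<le> -1" | m :: nat where "2 \<le> m" "B (\<alpha> s) (\<alpha> t) = - cos (pi / real m)"
    using off_diag[OF st] by auto
  then show ?thesis
  proof cases
    case 1
    from alternating_cone_of_form_le_minus_1[OF st(1,2) this, of 0 1 k] g_alternating show ?thesis by simp
  next
    case (2 m)
    define \<theta> where "\<theta> = pi / real m"
    have th: "0 < \<theta>" "\<theta> < pi" "real m * \<theta> = pi"
      using 2(1) by (auto simp: \<theta>_def field_simps)
    have s_pos: "sin \<theta> > 0" using sin_gt_zero[OF th(1,2)] .
    show ?thesis
    proof (cases "k < m")
      case True
      have "(real k + 1) * \<theta> \<le> real m * \<theta>"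
        using True th(1) by (intro mult_right_mono) auto
      then have "real k * \<theta> + \<theta> \<le> pi" by (simp add: algebra_simps flip: th(3))
      then have "sin (real k * \<theta> + \<theta>) \<ge> 0" "sin (real k * \<theta>) \<ge> 0"
        using th(1) by (auto intro!: sin_ge_zero)
      then have nn: "sin (real k * \<theta> + \<theta>) / sin \<theta> \<ge> 0" "sin (real k * \<theta>) / sin \<theta> \<ge> 0"
        using s_pos by auto
      have "\<alpha> s = polar \<theta> s t 0" using s_pos by (simp add: polar_def)
      then have "g (\<alpha> s) = (if even k then polar \<theta> s t (k * \<theta>) else polar \<theta> t s (k * \<theta>))"
        using alternating_polar[OF st(1,2), of \<theta> k 0] s_pos 2 by (simp add: g_alternating \<theta>_def)
      then show ?thesis
        using nn unfolding polar_def by (metis add.commute)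
    next
      case False
      obtain p where p: "p \<in> lists {s, t}" "length p = k - m" "alternating s t k = p @ alternating s t m"
        using alternating_split[of s t "k - m" m] False by auto
      obtain n where n: "m = Suc n" using 2 by (cases m) auto
      have "g \<circ> reflection B (\<alpha> s) = word_map p \<circ> word_map (alternating t s m) \<circ> reflection B (\<alpha> s)"
        using braid[OF st(1,2) 2(2,1)] by (simp add: g_alternating p)
      also have "\<dots> = word_map (p @ alternating s t n)"
        by (simp add: n comp_assoc refl_comp_refl st)
      finally show ?thesis
        using no_short[of "p @ alternating s t n"] p alternating_in_lists[of s t n] n False by simp
    qed
  qed
qed

section \<open>Positive and negative roots\<close>

definition cone :: "'v set" where
  "cone = {x. \<exists>a. (\<forall>s\<in>S. 0 \<le> a s) \<and> x = (\<Sum>s\<in>S. a s *\<^sub>R \<alpha> s)}"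

lemma cone_lincomb:
  assumes "x \<in> cone" "y \<in> cone" "0 \<le> a" "0 \<le> b"
  shows "a *\<^sub>R x + b *\<^sub>R y \<in> cone"
proof -
  obtain f h where *: "\<forall>s\<in>S. 0 \<le> f s" "x = (\<Sum>s\<in>S. f s *\<^sub>R \<alpha> s)"
    "\<forall>s\<in>S. 0 \<le> h s" "y = (\<Sum>s\<in>S. h s *\<^sub>R \<alpha> s)"
    using assms(1,2) by (auto simp: cone_def)
  then have "a *\<^sub>R x + b *\<^sub>R y = (\<Sum>s\<in>S. (a * f s + b * h s) *\<^sub>R \<alpha> s)"
    by (simp add: scaleR_sum_right scaleR_add_left sum.distrib)
  with * assms(3,4) show ?thesis
    unfolding cone_def by (intro CollectI exI[of _ "\<lambda>s. a * f s + b * h s"]) auto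
qed

lemma simple_in_cone: "s \<in> S \<Longrightarrow> \<alpha> s \<in> cone"
  unfolding cone_def
  by (intro CollectI exI[of _ "\<lambda>t. if t = s then 1 else 0"])
    (auto simp: if_distrib[of "\<lambda>c. c *\<^sub>R _"] fin cong: if_cong)

text \<open>
  This is where positive independence of the simple roots enters: adding the coefficients of \<open>x\<close>
  and \<open>- x\<close> gives a nonnegative relation.
\<close>

lemma cone_pointed:
  assumes "x \<in> cone" "- x \<in> cone"
  shows "x = 0"
proof -
  obtain f h where *: "\<forall>s\<in>S. 0 \<le> f s" "x = (\<Sum>s\<in>S. f s *\<^sub>R \<alpha> s)"
    "\<forall>s\<in>S. 0 \<le> h s" "- x = (\<Sum>s\<in>S. h s *\<^sub>R \<alpha> s)"
    using assms by (auto simp: cone_def)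
  have "(\<Sum>s\<in>S. (f s + h s) *\<^sub>R \<alpha> s) = x + - x"
    by (simp only: *(4) scaleR_add_left sum.distrib flip: *(2))
  then have "f t + h t = 0" if "t \<in> S" for t
    using pos_indep[of "\<lambda>s. f s + h s" t] * that by simp
  then have "f t = 0" if "t \<in> S" for t
    using * that by (metis add_nonneg_eq_0_iff)
  then show ?thesis using *(2) by simp
qed

text \<open>
  Deodhar's argument, by induction on the length of \<open>g\<close>.  If \<open>t\<close> is the last letter of a reduced
  word for \<open>g\<close>, factor \<open>g = v u\<close> with \<open>u\<close> in the dihedral group of \<open>s\<close> and \<open>t\<close>, with lengths adding up
  to at most that of \<open>g\<close>, and with \<open>v\<close> as short as possible.  Then \<open>v\<close> maps \<open>\<alpha> s\<close> and \<open>\<alpha> t\<close> into the cone by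
  induction, and \<open>u\<close> maps \<open>\<alpha> s\<close> to a nonnegative combination of \<open>\<alpha> s\<close> and \<open>\<alpha> t\<close>.
\<close>

lemma positive_of_len_le:
  assumes "g \<in> word_map ` lists S" "s \<in> S" "len S g \<le> len S (g \<circ> reflection B (\<alpha> s))"
  shows "g (\<alpha> s) \<in> cone"
  using assms
proof (induction "len S g" arbitrary: g s rule: less_induct)
  case less
  note g = less.prems(1) and s = less.prems(2) and le = less.prems(3)
  obtain ws where ws: "ws \<in> lists S" "length ws = len S g" "word_map ws = g"
    using reduced_word[OF g] by blast
  show ?case
  proof (cases ws rule: rev_cases)
    case Nil
    then show ?thesis using ws(3) s by (auto intro: simple_in_cone)
  next
    case (snoc ws' t)
    then have t: "t \<in> S" "ws' \<in> lists S" using ws(1) by auto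
    have "s \<noteq> t"
    proof
      assume "s = t"
      then have "g \<circ> reflection B (\<alpha> s) = word_map ws'"
        using ws(3) snoc t by (auto simp: comp_assoc refl_comp_refl)
      then show False using len_le[OF t(2)] le ws(2) snoc by simp
    qed
    let ?I = "{s, t}"
    define A where "A = (\<lambda>v. v \<in> word_map ` lists S \<and>
      (\<exists>u\<in>word_map ` lists ?I. g = v \<circ> u \<and> len S v + len ?I u \<le> len S g))"
    have A0: "A (word_map ws')"
      unfolding A_def
      using t ws snoc len_le[OF t(2)] len_refl_le[of t ?I] refl_in_words[of t ?I]
      by (auto intro!: bexI[of _ "reflection B (\<alpha> t)"])
    obtain v where v: "A v" "\<And>v'. A v' \<Longrightarrow> len S v \<le> len S v'"
      using ex_has_least_nat[of A _ "len S"] A0 by metis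
    then obtain u where u: "v \<in> word_map ` lists S" "u \<in> word_map ` lists ?I" "g = v \<circ> u"
      "len S v + len ?I u \<le> len S g"
      unfolding A_def by blast
    have lt: "len S v < len S g"
      using v(2)[OF A0] len_le[OF t(2)] ws(2) snoc by simp
    \<comment> \<open>Otherwise a factor \<open>r\<close> could be moved from \<open>v\<close> to \<open>u\<close>, contradicting the minimality of \<open>v\<close>.\<close>
    have v_min: "len S v \<le> len S (v \<circ> reflection B (\<alpha> r))" if r: "r \<in> ?I" for r
    proof (rule ccontr)
      assume less: "\<not> ?thesis"
      have rS: "r \<in> S" using r s t by auto
      have "g = (v \<circ> reflection B (\<alpha> r)) \<circ> (reflection B (\<alpha> r) \<circ> u)"
        using refl_comp_refl[OF rS] u(3) by (metis comp_assoc comp_id)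
      moreover have "len ?I (reflection B (\<alpha> r) \<circ> u) \<le> 1 + len ?I u"
        using len_comp_le[OF refl_in_words[OF r] u(2)] len_refl_le[OF r] by simp
      ultimately have "A (v \<circ> reflection B (\<alpha> r))"
        unfolding A_def using less u comp_in_words[OF u(1) refl_in_words[OF rS]]
          comp_in_words[OF refl_in_words[OF r] u(2)]
        by (auto intro!: bexI[of _ "reflection B (\<alpha> r) \<circ> u"])
      from v(2)[OF this] less show False by simp
    qed
    have pos: "v (\<alpha> s) \<in> cone" "v (\<alpha> t) \<in> cone"
      using less.hyps[OF lt u(1)] v_min s t by auto
    \<comment> \<open>Otherwise a shorter dihedral factor would make \<open>g s\<close> shorter than \<open>g\<close>.\<close>
    have "len ?I u \<le> len ?I (u \<circ> reflection B (\<alpha> s))"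
    proof (rule ccontr)
      assume less: "\<not> ?thesis"
      have us: "u \<circ> reflection B (\<alpha> s) \<in> word_map ` lists ?I"
        using comp_in_words[OF u(2)] refl_in_words[of s ?I] by simp
      then obtain x where x: "x \<in> lists ?I" "length x = len ?I (u \<circ> reflection B (\<alpha> s))"
        "word_map x = u \<circ> reflection B (\<alpha> s)"
        using reduced_word by blast
      have xS: "x \<in> lists S" using x(1) s t lists_mono[of ?I S] by auto
      have "len S (g \<circ> reflection B (\<alpha> s)) = len S (v \<circ> word_map x)"
        by (simp add: x(3) u(3) comp_assoc)
      also have "\<dots> \<le> len S v + length x"
        using len_comp_le[OF u(1) imageI[OF xS]] len_le[OF xS] by simp
      finally show False using le less u(4) x(2) by simp
    qed
    from dihedral_positive[OF s t(1) \<open>s \<noteq> t\<close> u(2) this]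
    obtain a b where "a \<ge> 0" "b \<ge> 0" "u (\<alpha> s) = a *\<^sub>R \<alpha> s + b *\<^sub>R \<alpha> t" by blast
    moreover obtain vs where "v = word_map vs" using u(1) by blast
    ultimately show ?thesis
      using pos by (simp add: u(3) word_map_lincomb cone_lincomb)
  qed
qed

definition word_roots :: "'v set" where
  "word_roots = {word_map ws (\<alpha> s) | ws s. ws \<in> lists S \<and> s \<in> S}"

lemma word_roots_cone:
  assumes "\<beta> \<in> word_roots"
  shows "\<beta> \<in> cone \<or> - \<beta> \<in> cone"
proof -
  obtain ws s where ws: "ws \<in> lists S" "s \<in> S" "\<beta> = word_map ws (\<alpha> s)"
    using assms by (auto simp: word_roots_def)
  let ?g = "word_map ws" and ?r = "reflection B (\<alpha> s)"
  have g: "?g \<in> word_map ` lists S" using ws by blast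
  show ?thesis
  proof (cases "len S ?g \<le> len S (?g \<circ> ?r)")
    case True
    then show ?thesis using positive_of_len_le[OF g ws(2)] ws by simp
  next
    case False
    have "?g \<circ> ?r \<circ> ?r = ?g" by (simp add: comp_assoc refl_comp_refl ws)
    then have "(?g \<circ> ?r) (\<alpha> s) \<in> cone"
      using False positive_of_len_le[OF comp_in_words[OF g refl_in_words[OF ws(2)]] ws(2)] by simp
    then show ?thesis using ws by (simp add: reflection_self unit word_map_neg)
  qed
qed

lemma word_roots_unit:
  assumes "\<beta> \<in> word_roots"
  shows "B \<beta> \<beta> = 1"
proof -
  obtain ws s where "ws \<in> lists S" "s \<in> S" "\<beta> = word_map ws (\<alpha> s)"
    using assms unfolding word_roots_def by blast
  then show ?thesis by (simp only: word_map_form unit)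
qed

lemma word_map_word_roots:
  assumes "ws \<in> lists S" "\<beta> \<in> word_roots"
  shows "word_map ws \<beta> \<in> word_roots"
proof -
  obtain us s where "us \<in> lists S" "s \<in> S" "\<beta> = word_map us (\<alpha> s)"
    using assms unfolding word_roots_def by blast
  then have "word_map ws \<beta> = word_map (ws @ us) (\<alpha> s)" "ws @ us \<in> lists S"
    using assms by auto
  then show ?thesis using \<open>s \<in> S\<close> unfolding word_roots_def by blast
qed

lemma not_both_cone: "\<beta> \<in> word_roots \<Longrightarrow> \<beta> \<in> cone \<Longrightarrow> - \<beta> \<notin> cone"
  using cone_pointed word_roots_unit by (fastforce simp: B_simps)

lemma off_diag_nonpos:
  assumes "s \<in> S" "t \<in> S" "s \<noteq> t"
  shows "B (\<alpha> s) (\<alpha> t) \<le> 0"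
proof -
  have "0 \<le> cos (pi / real k)" if "2 \<le> k" for k :: nat
  proof (rule cos_ge_zero)
    have "0 \<le> pi / real k" by simp
    then show "- (pi / 2) \<le> pi / real k" using pi_gt_zero by linarith
    show "pi / real k \<le> pi / 2" using that by (intro divide_left_mono) auto
  qed
  then show ?thesis using off_diag[OF assms] by auto
qed

text \<open>
  A simple reflection changes only the coefficient at \<open>\<alpha> s\<close>.  As the simple roots may be linearly
  dependent, coefficients cannot be compared directly; instead the sum of \<open>\<beta>\<close> and the negative of
  its image, which is a multiple of \<open>\<alpha> s\<close>, is rewritten as a nonnegative relation.  The multiple is
  bounded by the coefficient at \<open>\<alpha> s\<close> because distinct simple roots have nonpositive products.
\<close>

lemma simple_reflection_permutes_positive:
  assumes \<beta>: "\<beta> \<in> word_roots" "\<beta> \<in> cone" and s: "s \<in> S" and neg: "- reflection B (\<alpha> s) \<beta> \<in> cone"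
  shows "\<beta> = \<alpha> s"
proof -
  obtain a b where *: "\<forall>t\<in>S. 0 \<le> a t" "\<beta> = (\<Sum>t\<in>S. a t *\<^sub>R \<alpha> t)"
    "\<forall>t\<in>S. 0 \<le> b t" "- reflection B (\<alpha> s) \<beta> = (\<Sum>t\<in>S. b t *\<^sub>R \<alpha> t)"
    using \<beta>(2) neg by (auto simp: cone_def)
  define c where "c = 2 * B (\<alpha> s) \<beta>"
  define e where "e t = a t + b t" for t
  have "c *\<^sub>R \<alpha> s = \<beta> + - reflection B (\<alpha> s) \<beta>"
    by (simp add: reflection_def c_def)
  also have "\<dots> = (\<Sum>t\<in>S. e t *\<^sub>R \<alpha> t)"
    by (simp only: *(4) e_def scaleR_add_left sum.distrib flip: *(2))
  also have "\<dots> = e s *\<^sub>R \<alpha> s + (\<Sum>t\<in>S-{s}. e t *\<^sub>R \<alpha> t)"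
    by (rule sum.remove[OF fin s])
  finally have rest: "(c - e s) *\<^sub>R \<alpha> s = (\<Sum>t\<in>S-{s}. e t *\<^sub>R \<alpha> t)"
    by (simp add: algebra_simps)
  have lin: "linear (B (\<alpha> s))" using bilin by (simp add: bilinear_def)
  have "c - e s = B (\<alpha> s) ((c - e s) *\<^sub>R \<alpha> s)" by (simp add: B_simps unit s)
  also have "\<dots> = (\<Sum>t\<in>S-{s}. e t * B (\<alpha> s) (\<alpha> t))"
    unfolding rest by (simp add: linear_sum[OF lin] B_simps)
  also have "\<dots> \<le> 0"
    using * s by (intro sum_nonpos mult_nonneg_nonpos off_diag_nonpos) (auto simp: e_def)
  finally have ce: "c \<le> e s" by simp
  have "(\<Sum>t\<in>S. (if t = s then e s - c else e t) *\<^sub>R \<alpha> t) = (e s - c) *\<^sub>R \<alpha> s + (\<Sum>t\<in>S-{s}. e t *\<^sub>R \<alpha> t)"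
    by (subst sum.remove[OF fin s]) (auto intro!: sum.cong)
  also have "\<dots> = 0" by (simp flip: rest scaleR_add_left)
  finally have "e t = 0" if "t \<in> S" "t \<noteq> s" for t
    using pos_indep[of "\<lambda>t. if t = s then e s - c else e t" t] ce * that by (auto simp: e_def split: if_splits)
  then have "a t = 0" if "t \<in> S" "t \<noteq> s" for t
    using * that by (auto simp: e_def add_nonneg_eq_0_iff)
  then have "\<beta> = a s *\<^sub>R \<alpha> s"
    using sum.remove[OF fin s, of "\<lambda>t. a t *\<^sub>R \<alpha> t"] *(2) by simp
  moreover from this have "a s * a s = 1"
    using word_roots_unit[OF \<beta>(1)] s by (simp add: B_simps unit)
  then have "a s = 1"
    using * s by (metis abs_of_nonneg abs_square_eq_1 power2_eq_square)
  ultimately show ?thesis by simp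
qed

text \<open>
  Each letter \<open>s\<close> of the word adds at most one sign change, namely that of the root which the letters
  acting before it map to \<open>\<alpha> s\<close>.
\<close>

lemma finite_sign_changes:
  assumes "ws \<in> lists S"
  shows "finite {\<beta> \<in> word_roots. \<beta> \<in> cone \<and> - word_map ws \<beta> \<in> cone}" (is "finite (?N ws)")
  using assms
proof (induction ws)
  case Nil
  have "?N [] = {}" using not_both_cone by auto
  then show ?case by (metis finite.emptyI)
next
  case (Cons s ws)
  then have s: "s \<in> S" "ws \<in> lists S" by auto
  have "?N (s # ws) \<subseteq> ?N ws \<union> word_map ws -` {\<alpha> s}"
  proof
    fix \<beta> assume \<beta>: "\<beta> \<in> ?N (s # ws)"
    then have r: "word_map ws \<beta> \<in> word_roots" using word_map_word_roots s by blast
    have "word_map ws \<beta> = \<alpha> s" if "word_map ws \<beta> \<in> cone"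
      using simple_reflection_permutes_positive[OF r that s(1)] \<beta> by simp
    then show "\<beta> \<in> ?N ws \<union> word_map ws -` {\<alpha> s}"
      using word_roots_cone[OF r] \<beta> by auto
  qed
  moreover have "finite (word_map ws -` {\<alpha> s})"
    by (intro finite_vimageI inj_word_map s) simp
  ultimately show ?case using Cons.IH by (meson finite_UnI finite_subset)
qed

section \<open>Roots that change sign under a reflection\<close>

lemma reflection_in_word_map:
  assumes "\<beta> \<in> word_roots"
  obtains ws where "ws \<in> lists S" "reflection B \<beta> = word_map ws"
proof -
  obtain ws s where ws: "ws \<in> lists S" "s \<in> S" "\<beta> = word_map ws (\<alpha> s)"
    using assms unfolding word_roots_def by blast
  have rev: "rev ws \<in> lists S" using ws by auto
  have "reflection B \<beta> = word_map (ws @ [s] @ rev ws)"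
  proof
    fix x
    define y where "y = word_map (rev ws) x"
    have x: "x = word_map ws y"
      using word_map_rev[OF ws(1)] by (simp add: y_def fun_eq_iff)
    have "reflection B \<beta> x = 1 *\<^sub>R word_map ws y + (- 2 * B (\<alpha> s) y) *\<^sub>R word_map ws (\<alpha> s)"
      unfolding x ws(3) reflection_def word_map_form[OF ws(1)] by simp
    also have "\<dots> = word_map ws (reflection B (\<alpha> s) y)"
      by (simp only: reflection_def flip: word_map_lincomb) simp
    finally show "reflection B \<beta> x = word_map (ws @ [s] @ rev ws) x"
      by (simp add: y_def)
  qed
  moreover have "ws @ [s] @ rev ws \<in> lists S" using ws rev by auto
  ultimately show thesis using that by blast
qed

lemma inj_reflection: "B \<beta> \<beta> = 1 \<Longrightarrow> inj (reflection B \<beta>)"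
  by (rule inj_on_inverseI[of _ "reflection B \<beta>"]) (rule reflection_involutive)

lemma reflection_conjugate:
  assumes "B \<gamma> \<gamma> = 1"
  shows "reflection B (reflection B \<gamma> \<beta>) (reflection B \<gamma> x) = reflection B \<gamma> (reflection B \<beta> x)"
proof -
  have "reflection B (reflection B \<gamma> \<beta>) (reflection B \<gamma> x)
    = 1 *\<^sub>R reflection B \<gamma> x + (- 2 * B \<beta> x) *\<^sub>R reflection B \<gamma> \<beta>"
    by (simp add: reflection_def[of B "reflection B \<gamma> \<beta>"] reflection_form assms)
  also have "\<dots> = reflection B \<gamma> (reflection B \<beta> x)"
    by (simp only: reflection_def[of B \<beta>] flip: reflection_lincomb) simp
  finally show ?thesis .
qed

text \<open>
  An integer-valued indicator, so that sign changes can be summed and telescoped.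
\<close>

definition pos :: "'v \<Rightarrow> int" where
  "pos x = of_bool (x \<in> cone)"

definition crossing :: "'v \<Rightarrow> 'v set" where
  "crossing \<gamma> = {a \<in> word_roots. pos a \<noteq> pos (reflection B \<gamma> a)}"

lemma uminus_word_roots: "\<beta> \<in> word_roots \<Longrightarrow> - \<beta> \<in> word_roots"
proof -
  assume \<beta>: "\<beta> \<in> word_roots"
  obtain ws where "ws \<in> lists S" "reflection B \<beta> = word_map ws"
    using reflection_in_word_map[OF \<beta>] by blast
  then have "reflection B \<beta> \<beta> \<in> word_roots" using word_map_word_roots \<beta> by metis
  then show ?thesis by (simp add: reflection_self word_roots_unit \<beta>)
qed

lemma reflection_neg: "reflection B \<gamma> (- x) = - reflection B \<gamma> x"
  by (simp add: reflection_def B_simps)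

lemma finite_crossing:
  assumes "\<gamma> \<in> word_roots"
  shows "finite (crossing \<gamma>)"
proof -
  obtain ws where ws: "ws \<in> lists S" "reflection B \<gamma> = word_map ws"
    using reflection_in_word_map[OF assms] by blast
  let ?N = "{\<beta> \<in> word_roots. \<beta> \<in> cone \<and> - word_map ws \<beta> \<in> cone}"
  have "crossing \<gamma> \<subseteq> ?N \<union> uminus ` ?N"
  proof
    fix a assume a: "a \<in> crossing \<gamma>"
    then have r: "a \<in> word_roots" "word_map ws a \<in> word_roots"
      using word_map_word_roots ws by (auto simp: crossing_def)
    have "a \<in> ?N" if "a \<in> cone"
      using that a r word_roots_cone[OF r(2)] by (auto simp: crossing_def pos_def ws(2))
    moreover have "- a \<in> ?N" if "a \<notin> cone"
      using that a r word_roots_cone[OF r(1)] uminus_word_roots[OF r(1)]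
      by (auto simp: crossing_def pos_def ws(2) word_map_neg split: if_splits)
    ultimately show "a \<in> ?N \<union> uminus ` ?N"
      using image_eqI[of a uminus "- a" ?N] by (cases "a \<in> cone") simp_all
  qed
  then show ?thesis using finite_sign_changes[OF ws(1)] by (meson finite_UnI finite_imageI finite_subset)
qed

lemma cone_add_scaled: "x \<in> cone \<Longrightarrow> \<gamma> \<in> cone \<Longrightarrow> 0 \<le> c \<Longrightarrow> x + c *\<^sub>R \<gamma> \<in> cone"
  using cone_lincomb[of x \<gamma> 1 c] by simp

text \<open>
  A reflection in \<open>\<gamma> \<in> cone\<close> subtracts a multiple of \<open>\<gamma>\<close>, and only a positive multiple can lead out of
  the cone.
\<close>

lemma form_pos_of_leaving:
  assumes "\<gamma> \<in> cone" "x \<in> cone" "reflection B \<gamma> x \<notin> cone"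
  shows "0 < B \<gamma> x"
  using cone_add_scaled[OF assms(2,1), of "- 2 * B \<gamma> x"] assms(3)
  by (fastforce simp: reflection_def)

lemma form_neg_of_entering:
  assumes "\<gamma> \<in> cone" "x \<notin> cone" "reflection B \<gamma> x \<in> cone"
  shows "B \<gamma> x < 0"
  using cone_add_scaled[OF assms(3,1), of "2 * B \<gamma> x"] assms(2)
  by (fastforce simp: reflection_def)

section \<open>Signed counts and the effect of a reflection\<close>

definition reflection_closed :: "'v set \<Rightarrow> bool" where
  "reflection_closed \<Psi> \<longleftrightarrow> \<Psi> \<subseteq> word_roots \<and> (\<forall>\<gamma>\<in>\<Psi>. \<forall>\<beta>\<in>\<Psi>. reflection B \<gamma> \<beta> \<in> \<Psi>)"

text \<open>
  For \<open>\<beta> \<in> cone\<close> this counts the inversions of the reflection in \<open>\<beta>\<close> that lie in \<open>\<Psi>\<close> and have product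
  with \<open>\<beta>\<close> in \<open>X\<close>.  Both the \<open>X\<close>-length and its analogue for a reflection subgroup are instances
  of the signed version below, for \<open>\<Psi>\<close> the set of all roots and the set of roots of the subgroup.
\<close>

definition inv_count :: "'v set \<Rightarrow> real set \<Rightarrow> 'v \<Rightarrow> nat" where
  "inv_count \<Psi> X \<beta> = card {a \<in> \<Psi>. a \<in> cone \<and> - reflection B \<beta> a \<in> cone \<and> B a \<beta> \<in> X}"

definition signed_count :: "'v set \<Rightarrow> real set \<Rightarrow> 'v \<Rightarrow> int" where
  "signed_count \<Psi> X \<beta> = (if \<beta> \<in> cone then int (inv_count \<Psi> X \<beta>) else - int (inv_count \<Psi> X (- \<beta>)))"

text \<open>
  A formula that is uniform in the sign of \<open>\<beta>\<close>.  When \<open>B a \<beta> > 0\<close>, the reflection in \<open>\<beta>\<close> subtracts a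
  positive multiple of \<open>\<beta>\<close> from \<open>a\<close>, so for positive \<open>\<beta>\<close> it can only turn positive roots into
  negative ones, each contributing \<open>1\<close>; for negative \<open>\<beta>\<close> the opposite holds and each contributes
  \<open>-1\<close>.  The finite set \<open>E\<close> is left free so that one choice can serve several sums at once.
\<close>

lemma signed_count_sum:
  assumes \<Psi>: "reflection_closed \<Psi>" and X: "order_coideal X" and \<beta>: "\<beta> \<in> \<Psi>"
    and E: "finite E" "E \<subseteq> {a \<in> \<Psi>. B a \<beta> \<in> X}" "{a \<in> crossing \<beta> \<inter> \<Psi>. B a \<beta> \<in> X} \<subseteq> E"
  shows "signed_count \<Psi> X \<beta> = (\<Sum>a\<in>E. pos a - pos (reflection B \<beta> a))"
proof -
  let ?T = "{a \<in> crossing \<beta> \<inter> \<Psi>. B a \<beta> \<in> X}"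
  have roots: "a \<in> word_roots" "reflection B \<beta> a \<in> word_roots" if "a \<in> \<Psi>" for a
    using that \<Psi> \<beta> by (auto simp: reflection_closed_def)
  have pos_form: "0 < B \<beta> a" if "B a \<beta> \<in> X" for a
    using that X sym[of a \<beta>] by (auto simp: order_coideal_def)
  have neg_iff: "- a \<in> cone \<longleftrightarrow> a \<notin> cone" if "a \<in> word_roots" for a
    using that not_both_cone word_roots_cone by blast
  have "(\<Sum>a\<in>E. pos a - pos (reflection B \<beta> a)) = (\<Sum>a\<in>?T. pos a - pos (reflection B \<beta> a))"
    using E roots by (intro sum.mono_neutral_right) (auto simp: crossing_def)
  also have "\<dots> = signed_count \<Psi> X \<beta>"
  proof (cases "\<beta> \<in> cone")
    case True
    have T: "?T = {a \<in> \<Psi>. a \<in> cone \<and> - reflection B \<beta> a \<in> cone \<and> B a \<beta> \<in> X}"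
      using roots neg_iff form_neg_of_entering[OF True] pos_form
      by (fastforce simp: crossing_def pos_def split: if_splits)
    have "(\<Sum>a\<in>?T. pos a - pos (reflection B \<beta> a)) = (\<Sum>a\<in>?T. 1)"
      unfolding T using roots neg_iff by (intro sum.cong) (auto simp: pos_def)
    also have "\<dots> = int (inv_count \<Psi> X \<beta>)"
      unfolding T inv_count_def by simp
    finally show ?thesis using True by (simp add: signed_count_def)
  next
    case False
    then have neg: "- \<beta> \<in> cone" using neg_iff roots \<beta> by blast
    have refl_neg: "reflection B (- \<beta>) a = reflection B \<beta> a" for a
      by (simp add: reflection_def B_simps)
    have closed_neg: "- a \<in> \<Psi>" if "a \<in> \<Psi>" for a
      using that \<Psi> roots word_roots_unit reflection_self[of a]
      by (metis reflection_closed_def)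
    let ?T' = "{a \<in> \<Psi>. a \<in> cone \<and> - reflection B (- \<beta>) a \<in> cone \<and> B a (- \<beta>) \<in> X}"
    have not_leaving: "a \<notin> cone \<and> reflection B \<beta> a \<in> cone" if "a \<in> ?T" for a
    proof -
      have "\<not> (a \<in> cone \<and> reflection B \<beta> a \<notin> cone)"
        using form_pos_of_leaving[OF neg, of a] pos_form[of a] that by (auto simp: B_simps refl_neg)
      then show ?thesis using that by (auto simp: crossing_def pos_def split: if_splits)
    qed
    have T: "?T = uminus ` ?T'"
    proof (intro equalityI subsetI)
      fix a assume a: "a \<in> ?T"
      then have "- a \<in> ?T'"
        using not_leaving[OF a] closed_neg neg_iff roots
        by (auto simp: refl_neg reflection_neg B_simps)
      then show "a \<in> uminus ` ?T'" by (rule image_eqI[rotated]) simp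
    next
      fix a assume "a \<in> uminus ` ?T'"
      then obtain b where b: "a = - b" "b \<in> ?T'" by blast
      then have r: "- b \<in> \<Psi>" "- b \<in> word_roots" "b \<in> word_roots" "reflection B \<beta> b \<in> word_roots"
        using roots closed_neg by auto
      then show "a \<in> ?T"
        using b neg_iff[OF r(3)] neg_iff[OF r(4)]
        by (simp add: crossing_def pos_def reflection_neg refl_neg B_simps)
    qed
    have "(\<Sum>a\<in>?T. pos a - pos (reflection B \<beta> a)) = (\<Sum>a\<in>?T. -1)"
      using not_leaving by (intro sum.cong) (auto simp: pos_def)
    also have "\<dots> = - int (card ?T)" by simp
    also have "card ?T = inv_count \<Psi> X (- \<beta>)"
      unfolding T inv_count_def by (rule card_image) simp
    finally show ?thesis using False by (simp add: signed_count_def)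
  qed
  finally show ?thesis ..
qed

text \<open>
  The odd extension of the indicator function of \<open>X\<close>.  It is monotone on the whole real line because
  \<open>X\<close> is an order coideal of the positive reals.
\<close>

definition weight :: "real set \<Rightarrow> real \<Rightarrow> int" where
  "weight X x = of_bool (x \<in> X) - of_bool (- x \<in> X)"

lemma weight_mono:
  assumes "order_coideal X" "x \<le> y"
  shows "weight X x \<le> weight X y"
proof -
  have "y \<in> X" if "x \<in> X" using assms that by (auto simp: order_coideal_def)
  moreover have "- x \<in> X" if "- y \<in> X"
    using assms that by (auto simp: order_coideal_def)
  ultimately show ?thesis by (auto simp: weight_def)
qed

text \<open>
  The contribution of the root \<open>a\<close> to twice the increase of the signed count from \<open>\<beta>\<close> to its image
  under the reflection in \<open>\<gamma>\<close>.  It does not mention \<open>\<Psi>\<close>, which is what allows the increases for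
  different sets of roots to be compared.
\<close>

definition gain :: "real set \<Rightarrow> 'v \<Rightarrow> 'v \<Rightarrow> 'v \<Rightarrow> int" where
  "gain X \<gamma> \<beta> a = (pos (reflection B \<gamma> a) - pos a) * (weight X (B a \<beta>) - weight X (B (reflection B \<gamma> a) \<beta>))"

lemma form_reflection_left: "B (reflection B \<gamma> a) \<beta> = B a \<beta> - 2 * B \<gamma> a * B \<gamma> \<beta>"
  by (simp add: reflection_def B_simps)

text \<open>
  The two factors have the same sign.  If the reflection in \<open>\<gamma>\<close> makes \<open>a\<close> negative, then
  \<open>B \<gamma> a > 0\<close>, so that \<open>B a \<beta>\<close> increases by \<open>- 2 (B \<gamma> a) (B \<gamma> \<beta>) > 0\<close>; if it makes \<open>a\<close>
  positive, all signs are reversed.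
\<close>

lemma gain_nonneg:
  assumes X: "order_coideal X" and "\<gamma> \<in> cone" "B \<gamma> \<beta> < 0"
  shows "0 \<le> gain X \<gamma> \<beta> a"
proof -
  consider "pos (reflection B \<gamma> a) = pos a" | "a \<in> cone" "reflection B \<gamma> a \<notin> cone"
    | "a \<notin> cone" "reflection B \<gamma> a \<in> cone"
    by (cases "a \<in> cone"; cases "reflection B \<gamma> a \<in> cone") (simp_all add: pos_def)
  then show ?thesis
  proof cases
    case 1
    then show ?thesis by (simp add: gain_def)
  next
    case 2
    have "B \<gamma> a * B \<gamma> \<beta> \<le> 0"
      using form_pos_of_leaving[OF assms(2) 2] assms(3) by (intro mult_nonneg_nonpos) auto
    then have "weight X (B a \<beta>) \<le> weight X (B (reflection B \<gamma> a) \<beta>)"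
      by (intro weight_mono[OF X]) (simp add: form_reflection_left mult.commute)
    with 2 show ?thesis by (simp add: gain_def pos_def)
  next
    case 3
    have "B \<gamma> a * B \<gamma> \<beta> \<ge> 0"
      using form_neg_of_entering[OF assms(2) 3] assms(3) by (intro mult_nonpos_nonpos) auto
    then have "weight X (B (reflection B \<gamma> a) \<beta>) \<le> weight X (B a \<beta>)"
      by (intro weight_mono[OF X]) (simp add: form_reflection_left mult.commute)
    with 3 show ?thesis by (simp add: gain_def pos_def)
  qed
qed

text \<open>
  Write \<open>w\<close> and \<open>r\<close> for the reflections in \<open>\<gamma>\<close> and \<open>\<beta>\<close>, and \<open>h a = pos (w a) - pos a\<close>.  Since
  \<open>w r w\<close> is the reflection in \<open>w \<beta>\<close>, substituting \<open>w a\<close> for \<open>a\<close> in the sum for \<open>w \<beta>\<close> expresses the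
  difference of the two counts as the sum of \<open>h a - h (r a)\<close> over the roots with \<open>B a \<beta> \<in> X\<close>.
  Substituting \<open>r a\<close> for \<open>a\<close> in the second half changes the condition to \<open>- B a \<beta> \<in> X\<close> and leaves the
  sum of \<open>h a * weight X (B a \<beta>)\<close>.  Finally \<open>h (w a) = - h a\<close>, and averaging over \<open>a\<close> and
  \<open>w a\<close> gives the gains.
\<close>

lemma signed_count_reflection:
  assumes \<Psi>: "reflection_closed \<Psi>" and X: "order_coideal X" and \<gamma>: "\<gamma> \<in> \<Psi>" and \<beta>: "\<beta> \<in> \<Psi>"
  shows "2 * (signed_count \<Psi> X (reflection B \<gamma> \<beta>) - signed_count \<Psi> X \<beta>)
    = (\<Sum>a\<in>crossing \<gamma> \<inter> \<Psi>. gain X \<gamma> \<beta> a)"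
proof -
  let ?w = "reflection B \<gamma>" and ?r = "reflection B \<beta>"
  define h where "h a = pos (?w a) - pos a" for a
  define C where "C = crossing \<gamma> \<inter> \<Psi>"
  have roots: "\<And>a. a \<in> \<Psi> \<Longrightarrow> a \<in> word_roots" and closed: "\<And>a b. a \<in> \<Psi> \<Longrightarrow> b \<in> \<Psi> \<Longrightarrow> reflection B a b \<in> \<Psi>"
    using \<Psi> by (auto simp: reflection_closed_def)
  have ug: "B \<gamma> \<gamma> = 1" and ub: "B \<beta> \<beta> = 1" using word_roots_unit roots \<gamma> \<beta> by blast+
  have ww: "?w (?w a) = a" and rr: "?r (?r a) = a" for a
    using reflection_involutive ug ub by blast+
  have iw: "inj_on ?w A" and ir: "inj_on ?r A" for A
    using inj_reflection[OF ug] inj_reflection[OF ub] by (meson inj_on_subset subset_UNIV)+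
  have fC: "finite C" using finite_crossing roots \<gamma> by (simp add: C_def)
  have C_iff: "a \<in> C \<longleftrightarrow> a \<in> \<Psi> \<and> h a \<noteq> 0" for a
    using roots by (auto simp: C_def crossing_def h_def)
  \<comment> \<open>\<open>T\<close> may be infinite; \<open>E\<close> is a finite part outside of which all terms of all sums vanish.\<close>
  define T where "T = {a \<in> \<Psi>. B a \<beta> \<in> X}"
  define E where "E = T \<inter> (crossing \<beta> \<union> C \<union> ?r -` C)"
  have fE: "finite E"
    unfolding E_def using finite_crossing[OF roots[OF \<beta>]] fC inj_reflection[OF ub]
    by (auto intro: finite_vimageI)
  have ET: "E \<subseteq> T" by (auto simp: E_def)
  have before: "signed_count \<Psi> X \<beta> = (\<Sum>a\<in>E. pos a - pos (?r a))"
    by (rule signed_count_sum[OF \<Psi> X \<beta> fE]) (auto simp: E_def T_def)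
  have "signed_count \<Psi> X (?w \<beta>) = (\<Sum>a\<in>?w ` E. pos a - pos (reflection B (?w \<beta>) a))"
  proof (rule signed_count_sum[OF \<Psi> X closed[OF \<gamma> \<beta>]])
    show "finite (?w ` E)" using fE by simp
    show "?w ` E \<subseteq> {a \<in> \<Psi>. B a (?w \<beta>) \<in> X}"
      using ET by (auto simp: T_def closed \<gamma> reflection_form ug)
    show "{a \<in> crossing (?w \<beta>) \<inter> \<Psi>. B a (?w \<beta>) \<in> X} \<subseteq> ?w ` E"
    proof
      fix a assume a: "a \<in> {a \<in> crossing (?w \<beta>) \<inter> \<Psi>. B a (?w \<beta>) \<in> X}"
      define b where "b = ?w a"
      have ab: "a = ?w b" by (simp add: b_def ww)
      have b: "b \<in> \<Psi>" "?r b \<in> \<Psi>" using a by (auto simp: b_def closed \<gamma> \<beta>)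
      have "B b \<beta> \<in> X" using a by (simp add: ab reflection_form ug)
      moreover have "pos (?w b) \<noteq> pos (?w (?r b))"
        using a by (simp add: ab crossing_def reflection_conjugate ug)
      then have "pos b \<noteq> pos (?r b) \<or> h b \<noteq> 0 \<or> h (?r b) \<noteq> 0"
        by (auto simp: h_def)
      ultimately have "b \<in> E"
        using b roots by (auto simp: E_def T_def C_iff crossing_def)
      then show "a \<in> ?w ` E" using ab by blast
    qed
  qed
  also have "\<dots> = (\<Sum>a\<in>E. pos (?w a) - pos (?w (?r a)))"
    by (simp add: sum.reindex[OF iw] reflection_conjugate ug)
  finally have "signed_count \<Psi> X (?w \<beta>) - signed_count \<Psi> X \<beta> = (\<Sum>a\<in>E. h a) - (\<Sum>a\<in>E. h (?r a))"
    by (simp add: before h_def algebra_simps flip: sum_subtractf)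
  also have "(\<Sum>a\<in>E. h a) = (\<Sum>a\<in>C. of_bool (B a \<beta> \<in> X) * h a)"
  proof -
    have "(\<Sum>a\<in>E. h a) = (\<Sum>a\<in>C \<inter> {a. B a \<beta> \<in> X}. h a)"
      using fE ET by (intro sum.mono_neutral_right) (auto simp: E_def T_def C_iff)
    also have "\<dots> = (\<Sum>a\<in>C. of_bool (B a \<beta> \<in> X) * h a)"
      using fC by (auto simp: sum.inter_restrict intro!: sum.cong)
    finally show ?thesis .
  qed
  also have "(\<Sum>a\<in>E. h (?r a)) = (\<Sum>a\<in>C. of_bool (- B a \<beta> \<in> X) * h a)"
  proof -
    have flip: "B (?r a) \<beta> = - B a \<beta>" for a
      by (simp add: reflection_def B_simps ub sym[of \<beta> a])
    have "(\<Sum>a\<in>E. h (?r a)) = (\<Sum>a\<in>?r ` E. h a)"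
      by (simp add: sum.reindex[OF ir])
    also have "\<dots> = (\<Sum>a\<in>C \<inter> {a. - B a \<beta> \<in> X}. h a)"
    proof (rule sum.mono_neutral_right)
      show "finite (?r ` E)" using fE by simp
      show "C \<inter> {a. - B a \<beta> \<in> X} \<subseteq> ?r ` E"
      proof
        fix a assume a: "a \<in> C \<inter> {a. - B a \<beta> \<in> X}"
        then have "?r a \<in> E"
          using \<beta> closed by (auto simp: E_def T_def C_iff rr flip)
        then show "a \<in> ?r ` E" by (rule image_eqI[rotated]) (simp add: rr)
      qed
      show "\<forall>a\<in>?r ` E - C \<inter> {a. - B a \<beta> \<in> X}. h a = 0"
        using ET \<beta> closed by (auto simp: T_def C_iff flip)
    qed
    also have "\<dots> = (\<Sum>a\<in>C. of_bool (- B a \<beta> \<in> X) * h a)"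
      using fC by (auto simp: sum.inter_restrict intro!: sum.cong)
    finally show ?thesis .
  qed
  finally have diff: "signed_count \<Psi> X (?w \<beta>) - signed_count \<Psi> X \<beta> = (\<Sum>a\<in>C. h a * weight X (B a \<beta>))"
    by (simp add: weight_def algebra_simps flip: sum_subtractf)
  have "?w ` C \<subseteq> C"
    using \<gamma> closed by (auto simp: C_iff h_def ww)
  moreover from image_mono[OF this, of ?w] have "C \<subseteq> ?w ` C"
    by (simp add: image_image ww)
  ultimately have "?w ` C = C" by blast
  then have "(\<Sum>a\<in>C. h a * weight X (B a \<beta>)) = (\<Sum>a\<in>C. h (?w a) * weight X (B (?w a) \<beta>))"
    using sum.reindex[OF iw, of "\<lambda>a. h a * weight X (B a \<beta>)" C] by simp
  also have "\<dots> = - (\<Sum>a\<in>C. h a * weight X (B (?w a) \<beta>))"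
    by (simp add: h_def ww algebra_simps flip: sum_negf)
  finally have "2 * (\<Sum>a\<in>C. h a * weight X (B a \<beta>))
    = (\<Sum>a\<in>C. h a * weight X (B a \<beta>)) - (\<Sum>a\<in>C. h a * weight X (B (?w a) \<beta>))"
    by simp
  also have "\<dots> = (\<Sum>a\<in>C. gain X \<gamma> \<beta> a)"
    by (simp add: gain_def h_def algebra_simps flip: sum_subtractf)
  finally show ?thesis by (simp add: diff C_def)
qed

lemma word_roots_reflection_closed: "reflection_closed word_roots"
  unfolding reflection_closed_def
  by (metis reflection_in_word_map subset_refl word_map_word_roots)

lemma signed_count_mono:
  assumes "reflection_closed \<Psi>" "order_coideal X" "\<gamma> \<in> \<Psi>" "\<gamma> \<in> cone" "\<beta> \<in> \<Psi>" "B \<gamma> \<beta> < 0"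
  shows "signed_count \<Psi> X \<beta> \<le> signed_count \<Psi> X (reflection B \<gamma> \<beta>)"
proof -
  have "0 \<le> (\<Sum>a\<in>crossing \<gamma> \<inter> \<Psi>. gain X \<gamma> \<beta> a)"
    using gain_nonneg assms by (intro sum_nonneg) auto
  then show ?thesis using signed_count_reflection[OF assms(1-3,5)] by simp
qed

text \<open>
  The smaller set sums the same nonnegative gains over fewer roots.
\<close>

lemma signed_count_increment_mono:
  assumes \<Psi>: "reflection_closed \<Psi>" "reflection_closed \<Psi>'" "\<Psi>' \<subseteq> \<Psi>"
    and "order_coideal X" "\<gamma> \<in> \<Psi>'" "\<gamma> \<in> cone" "\<beta> \<in> \<Psi>'" "B \<gamma> \<beta> < 0"
  shows "signed_count \<Psi>' X (reflection B \<gamma> \<beta>) - signed_count \<Psi>' X \<beta>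
    \<le> signed_count \<Psi> X (reflection B \<gamma> \<beta>) - signed_count \<Psi> X \<beta>"
proof -
  have r: "\<gamma> \<in> word_roots" "\<gamma> \<in> \<Psi>" "\<beta> \<in> \<Psi>" using assms by (auto simp: reflection_closed_def)
  have "(\<Sum>a\<in>crossing \<gamma> \<inter> \<Psi>'. gain X \<gamma> \<beta> a) \<le> (\<Sum>a\<in>crossing \<gamma> \<inter> \<Psi>. gain X \<gamma> \<beta> a)"
    using finite_crossing[OF r(1)] gain_nonneg assms by (intro sum_mono2) auto
  then show ?thesis
    using signed_count_reflection[OF \<Psi>(2) assms(4,5,7)] signed_count_reflection[OF \<Psi>(1) assms(4) r(2,3)]
    by simp
qed

lemma inv_count_mono:
  assumes "\<Psi>' \<subseteq> \<Psi>" "\<Psi> \<subseteq> word_roots" "\<beta> \<in> word_roots"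
  shows "inv_count \<Psi>' X \<beta> \<le> inv_count \<Psi> X \<beta>"
  unfolding inv_count_def
proof (rule card_mono)
  have "{a \<in> \<Psi>. a \<in> cone \<and> - reflection B \<beta> a \<in> cone \<and> B a \<beta> \<in> X} \<subseteq> crossing \<beta>"
  proof
    fix a assume a: "a \<in> {a \<in> \<Psi>. a \<in> cone \<and> - reflection B \<beta> a \<in> cone \<and> B a \<beta> \<in> X}"
    then have "reflection B \<beta> a \<in> word_roots"
      using word_roots_reflection_closed assms by (auto simp: reflection_closed_def)
    then show "a \<in> crossing \<beta>"
      using a assms not_both_cone by (auto simp: crossing_def pos_def)
  qed
  then show "finite {a \<in> \<Psi>. a \<in> cone \<and> - reflection B \<beta> a \<in> cone \<and> B a \<beta> \<in> X}"
    using finite_crossing[OF assms(3)] finite_subset by blast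
qed (use assms in auto)

end

section \<open>Transfer to geometric representations\<close>

context geometric_representation
begin

sublocale simple_system "form W" "gens W" "simple_root W"
  by unfold_locales
    (fact form_bilinear form_sym finite_gens simple_pos_indep simple_form simple_norm)+

sublocale group W
  using coxeter by (simp add: coxeter_system_def)

lemma gens_closed: "gens W \<subseteq> carrier W"
  and gens_generate: "generate W (gens W) = carrier W"
  using coxeter by (simp_all add: coxeter_system_def coxeter_system_axioms_def)

lemma act_isometry: "w \<in> carrier W \<Longrightarrow> act W w \<in> carrier (isometry_group (form W))"
  using act_hom by (rule hom_in_carrier)

lemma act_mult: "\<lbrakk>v \<in> carrier W; w \<in> carrier W\<rbrakk> \<Longrightarrow> act W (v \<otimes> w) = act W v \<circ> act W w"
  using hom_mult[OF act_hom] by (simp add: isometry_group_def)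

lemma act_one: "act W \<one> = id"
proof -
  have inj: "inj (act W \<one>)"
    using act_isometry[OF one_closed] by (simp add: isometry_group_def bij_def)
  have "act W \<one> (act W \<one> x) = act W \<one> x" for x
    using act_mult[OF one_closed one_closed] by (simp add: fun_eq_iff)
  then show ?thesis
    using injD[OF inj] by (simp add: fun_eq_iff)
qed

lemma act_inv_comp: "w \<in> carrier W \<Longrightarrow> act W (inv w) \<circ> act W w = id"
  using act_mult[of "inv w" w] by (simp add: act_one)

text \<open>
  Words without formal inverses suffice because the generators act as involutions.
\<close>

lemma act_words: "act W ` carrier W = word_map ` lists (gens W)"
proof
  have "\<exists>ws\<in>lists (gens W). act W w = word_map ws" if "w \<in> generate W (gens W)" for w
    using that
  proof induction
    case one
    show ?case by (rule bexI[of _ "[]"]) (simp_all add: act_one)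
  next
    case (incl s)
    then show ?case by (intro bexI[of _ "[s]"]) (auto simp: act_gens)
  next
    case (inv s)
    have "act W (inv s) = act W (inv s) \<circ> (act W s \<circ> act W s)"
      using refl_comp_refl[OF inv] by (simp add: act_gens inv)
    also have "\<dots> = act W s"
      using act_inv_comp[of s] inv gens_closed by (auto simp flip: comp_assoc)
    finally show ?case using inv by (intro bexI[of _ "[s]"]) (auto simp: act_gens)
  next
    case (eng v w)
    then obtain us ws where "us \<in> lists (gens W)" "ws \<in> lists (gens W)"
      "act W v = word_map us" "act W w = word_map ws" by blast
    moreover have "v \<in> carrier W" "w \<in> carrier W" using eng gens_generate by auto
    ultimately show ?case by (intro bexI[of _ "us @ ws"]) (auto simp: act_mult)
  qed
  then show "act W ` carrier W \<subseteq> word_map ` lists (gens W)"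
    unfolding gens_generate by blast
next
  have "\<exists>w\<in>carrier W. act W w = word_map ws" if "ws \<in> lists (gens W)" for ws
    using that
  proof (induction ws)
    case Nil
    show ?case by (rule bexI[of _ \<one>]) (simp_all add: act_one)
  next
    case (Cons s ws)
    then obtain w where "w \<in> carrier W" "act W w = word_map ws" by blast
    then show ?case
      using Cons.hyps gens_closed by (intro bexI[of _ "s \<otimes> w"]) (auto simp: act_mult act_gens)
  qed
  then show "word_map ` lists (gens W) \<subseteq> act W ` carrier W"
    by (intro image_subsetI) (simp only: image_iff, metis)
qed

lemma roots_eq: "roots W = word_roots"
proof -
  have "roots W = {g (simple_root W s) | g s. g \<in> act W ` carrier W \<and> s \<in> gens W}"
    unfolding roots_def by blast
  also have "\<dots> = word_roots"
    unfolding act_words word_roots_def by blast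
  finally show ?thesis .
qed

lemma pos_roots_eq: "pos_roots W = word_roots \<inter> cone"
  by (auto simp: pos_roots_def cone_def roots_eq)

lemma neg_roots_eq: "neg_roots W = {\<beta> \<in> word_roots. - \<beta> \<in> cone}"
proof -
  have "\<beta> \<in> uminus ` (word_roots \<inter> cone)" if "\<beta> \<in> word_roots" "- \<beta> \<in> cone" for \<beta>
    using that uminus_word_roots by (intro image_eqI[of _ _ "- \<beta>"]) auto
  then show ?thesis
    unfolding neg_roots_def pos_roots_eq using uminus_word_roots by auto
qed

lemma root_refl_props:
  assumes "\<beta> \<in> word_roots"
  shows "root_refl W \<beta> \<in> carrier W" "act W (root_refl W \<beta>) = reflection (form W) \<beta>"
proof -
  have "reflection (form W) \<beta> \<in> act W ` carrier W"
    unfolding act_words using reflection_in_word_map[OF assms] by blast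
  then show "root_refl W \<beta> \<in> carrier W" "act W (root_refl W \<beta>) = reflection (form W) \<beta>"
    unfolding root_refl_def
    by (auto simp: f_the_inv_into_f[OF act_faithful] intro: the_inv_into_into[OF act_faithful])
qed

lemma root_refl_unique:
  "\<lbrakk>\<beta> \<in> word_roots; w \<in> carrier W; act W w = reflection (form W) \<beta>\<rbrakk> \<Longrightarrow> root_refl W \<beta> = w"
  using act_faithful root_refl_props[of \<beta>] by (metis inj_onD)

lemma inversions_root_refl:
  assumes "\<beta> \<in> word_roots"
  shows "inversions W (root_refl W \<beta>)
    = {a \<in> word_roots. a \<in> cone \<and> - reflection (form W) \<beta> a \<in> cone}"
proof -
  note inv = reflection_involutive[OF word_roots_unit[OF assms]]
  have closed: "reflection (form W) \<beta> a \<in> word_roots" if "a \<in> word_roots" for a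
    using word_roots_reflection_closed assms that by (simp add: reflection_closed_def)
  have "a \<in> reflection (form W) \<beta> ` neg_roots W" if "a \<in> word_roots" "- reflection (form W) \<beta> a \<in> cone" for a
    using that closed by (intro image_eqI[of _ _ "reflection (form W) \<beta> a"]) (auto simp: inv neg_roots_eq)
  then show ?thesis
    unfolding inversions_def root_refl_props(2)[OF assms] pos_roots_eq
    by (auto simp: neg_roots_eq inv)
qed

lemma X_length_eq:
  assumes "\<beta> \<in> word_roots"
  shows "X_length W X \<beta> = signed_count word_roots X \<beta>"
  using assms uminus_word_roots[OF assms]
  by (simp add: X_length_def signed_count_def inv_count_def Let_def pos_roots_eq
      inversions_root_refl conj_assoc)

lemma sub_roots_subset: "sub_roots W W' \<subseteq> word_roots"
  by (auto simp: sub_roots_def roots_eq)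

lemma uminus_sub_roots: "\<beta> \<in> sub_roots W W' \<Longrightarrow> - \<beta> \<in> sub_roots W W'"
proof -
  have "reflection (form W) (- \<beta>) = reflection (form W) \<beta>"
    by (simp add: fun_eq_iff reflection_def B_simps)
  then show "\<beta> \<in> sub_roots W W' \<Longrightarrow> - \<beta> \<in> sub_roots W W'"
    by (simp add: sub_roots_def roots_eq root_refl_def uminus_word_roots)
qed

lemma sub_X_length_eq:
  assumes "\<beta> \<in> sub_roots W W'"
  shows "sub_X_length W W' X \<beta> = signed_count (sub_roots W W') X \<beta>"
proof -
  have "{a \<in> inversions W (root_refl W \<beta>) \<inter> sub_roots W W'. form W a \<beta> \<in> X}
    = {a \<in> sub_roots W W'. a \<in> cone \<and> - reflection (form W) \<beta> a \<in> cone \<and> form W a \<beta> \<in> X}"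
    if "\<beta> \<in> sub_roots W W'" for \<beta>
    using that sub_roots_subset[of W'] by (auto simp: inversions_root_refl subset_iff)
  then show ?thesis
    using assms uminus_sub_roots[OF assms] sub_roots_subset[of W']
    by (simp add: sub_X_length_def signed_count_def inv_count_def Let_def sub_pos_roots_def
        pos_roots_eq subset_iff)
qed

text \<open>
  The reflection in \<open>s\<^sub>\<gamma> \<beta>\<close> is the conjugate \<open>s\<^sub>\<gamma> s\<^sub>\<beta> s\<^sub>\<gamma>\<close>, which lies in the subgroup if both factors do.
\<close>

lemma sub_roots_reflection_closed:
  assumes "reflection_subgroup W W'"
  shows "reflection_closed (sub_roots W W')"
proof -
  obtain R where R: "R \<subseteq> word_roots" "W' = generate W (root_refl W ` R)"
    using assms by (auto simp: reflection_subgroup_def roots_eq)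
  have "root_refl W ` R \<subseteq> carrier W" using R root_refl_props by blast
  then interpret W': subgroup W' W unfolding R(2) by (rule generate_is_subgroup)
  have "reflection (form W) \<gamma> \<beta> \<in> sub_roots W W'"
    if "\<gamma> \<in> sub_roots W W'" "\<beta> \<in> sub_roots W W'" for \<gamma> \<beta>
  proof -
    let ?g = "root_refl W \<gamma>" and ?b = "root_refl W \<beta>"
    have r: "\<gamma> \<in> word_roots" "\<beta> \<in> word_roots" using that sub_roots_subset by blast+
    have in_W': "?g \<in> W'" "?b \<in> W'" using that by (auto simp: sub_roots_def)
    have r': "reflection (form W) \<gamma> \<beta> \<in> word_roots"
      using word_roots_reflection_closed r by (simp add: reflection_closed_def)
    have u: "form W \<gamma> \<gamma> = 1" by (rule word_roots_unit[OF r(1)])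
    have "act W (?g \<otimes> ?b \<otimes> ?g) = reflection (form W) (reflection (form W) \<gamma> \<beta>)"
    proof
      fix x
      show "act W (?g \<otimes> ?b \<otimes> ?g) x = reflection (form W) (reflection (form W) \<gamma> \<beta>) x"
        using reflection_conjugate[OF u, of \<beta> "reflection (form W) \<gamma> x"]
        by (simp add: act_mult root_refl_props r reflection_involutive[OF u])
    qed
    then have "root_refl W (reflection (form W) \<gamma> \<beta>) = ?g \<otimes> ?b \<otimes> ?g"
      by (intro root_refl_unique r') (simp_all add: root_refl_props r)
    then show ?thesis
      using in_W' r' by (simp add: sub_roots_def roots_eq)
  qed
  then show ?thesis
    using sub_roots_subset by (simp add: reflection_closed_def)
qed

end

section \<open>Monotonicity along the Bruhat orders\<close>

theorem theorem5p26:
  fixes W :: "('w, 'v::real_vector, 'm) coxeter_data_scheme"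
    and W' :: "'w set" and X :: "real set"
  assumes "geometric_representation W"
    and "order_coideal X"
    and "reflection_subgroup W W'"
  shows "(\<forall>\<beta>\<in>roots W. \<forall>\<beta>'\<in>roots W. bruhat_le W \<beta> \<beta>' \<longrightarrow> X_length W X \<beta> \<le> X_length W X \<beta>')
    \<and> (\<forall>\<beta>\<in>sub_roots W W'. \<forall>\<beta>'\<in>sub_roots W W'. sub_bruhat_le W W' \<beta> \<beta>' \<longrightarrow>
          bruhat_le W \<beta> \<beta>'
          \<and> 0 \<le> sub_X_length W W' X \<beta>' - sub_X_length W W' X \<beta>
          \<and> sub_X_length W W' X \<beta>' - sub_X_length W W' X \<beta> \<le> X_length W X \<beta>' - X_length W X \<beta>)
    \<and> (\<forall>\<beta>'\<in>sub_pos_roots W W'.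
          0 \<le> sub_X_length W W' X \<beta>' \<and> sub_X_length W W' X \<beta>' \<le> X_length W X \<beta>')"
proof -
  interpret geometric_representation W by fact
  note X = \<open>order_coideal X\<close>
  let ?\<Psi> = "sub_roots W W'"
  note closed = sub_roots_reflection_closed[OF assms(3)]
  note in_roots = subsetD[OF sub_roots_subset]
  have step: "X_length W X \<beta> \<le> X_length W X \<beta>'" if step: "bruhat_step W \<beta> \<beta>'" for \<beta> \<beta>'
  proof -
    obtain \<gamma> where "\<beta> \<in> word_roots" "\<beta>' \<in> word_roots" "\<gamma> \<in> word_roots" "\<gamma> \<in> cone"
      "form W \<gamma> \<beta> < 0" "\<beta>' = reflection (form W) \<gamma> \<beta>"
      using step by (auto simp: bruhat_step_def roots_eq pos_roots_eq)
    then show ?thesis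
      using signed_count_mono[OF word_roots_reflection_closed X] by (simp add: X_length_eq)
  qed
  have part1: "X_length W X \<beta> \<le> X_length W X \<beta>'" if "bruhat_le W \<beta> \<beta>'" for \<beta> \<beta>'
    using that unfolding bruhat_le_def by induction (use step in force)+
  have sub_step: "bruhat_step W \<beta> \<beta>' \<and> sub_X_length W W' X \<beta> \<le> sub_X_length W W' X \<beta>'
      \<and> sub_X_length W W' X \<beta>' - sub_X_length W W' X \<beta> \<le> X_length W X \<beta>' - X_length W X \<beta>"
    if step: "sub_bruhat_step W W' \<beta> \<beta>'" for \<beta> \<beta>'
  proof -
    obtain \<gamma> where *: "\<beta> \<in> ?\<Psi>" "\<beta>' \<in> ?\<Psi>" "\<gamma> \<in> ?\<Psi>" "\<gamma> \<in> cone"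
      "form W \<gamma> \<beta> < 0" "\<beta>' = reflection (form W) \<gamma> \<beta>"
      using step by (auto simp: sub_bruhat_step_def sub_pos_roots_def pos_roots_eq)
    have "bruhat_step W \<beta> \<beta>'"
      unfolding bruhat_step_def roots_eq pos_roots_eq using * in_roots by blast
    moreover have "sub_X_length W W' X \<beta> \<le> sub_X_length W W' X \<beta>'"
      using signed_count_mono[OF closed X *(3,4,1,5)] *(1,2,6) by (simp add: sub_X_length_eq)
    moreover have "sub_X_length W W' X \<beta>' - sub_X_length W W' X \<beta> \<le> X_length W X \<beta>' - X_length W X \<beta>"
      using signed_count_increment_mono[OF word_roots_reflection_closed closed sub_roots_subset X *(3,4,1,5)]
        *(1,2,6) in_roots[OF *(1)] in_roots[OF *(2)]
      by (simp add: sub_X_length_eq X_length_eq)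
    ultimately show ?thesis by blast
  qed
  have part2: "bruhat_le W \<beta> \<beta>' \<and> sub_X_length W W' X \<beta> \<le> sub_X_length W W' X \<beta>'
      \<and> sub_X_length W W' X \<beta>' - sub_X_length W W' X \<beta> \<le> X_length W X \<beta>' - X_length W X \<beta>"
    if "sub_bruhat_le W W' \<beta> \<beta>'" for \<beta> \<beta>'
    using that unfolding sub_bruhat_le_def bruhat_le_def
  proof induction
    case (step \<beta>' \<beta>'')
    then show ?case
      using sub_step[OF step.hyps(2)] by (auto intro: rtranclp.rtrancl_into_rtrancl)
  qed simp
  have part3: "0 \<le> sub_X_length W W' X \<beta> \<and> sub_X_length W W' X \<beta> \<le> X_length W X \<beta>"
    if "\<beta> \<in> sub_pos_roots W W'" for \<beta>
  proof -
    have "\<beta> \<in> ?\<Psi>" "\<beta> \<in> word_roots" "\<beta> \<in> cone"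
      using that by (auto simp: sub_pos_roots_def pos_roots_eq)
    then show ?thesis
      using inv_count_mono[OF sub_roots_subset order_refl, of \<beta> W' X]
      by (simp add: sub_X_length_eq X_length_eq signed_count_def)
  qed
  show ?thesis
    using part1 part2 part3 by auto
qed

end
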